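(* Let $\mathbb{C}$ be a category, let $(\mathcal{F},\mathfrak{f}):\mathbb{C}^{\mathrm{op}}\to\mathrm{Cat}$ be a pseudofunctor (indexed category), and let $a:\Delta_3^{\mathrm{op}}\to\mathbb{C}$ be a functor (a precategory in $\mathbb{C}$). Then the forgetful functor $$\mathcal{F}\text{-}\mathrm{IntAct}(a)\to\mathcal{F}\text{-}\mathrm{IntAct}\big(\overline{a(\mathsf{1})}\big)$$ from the category of $\mathcal{F}$-internal actions of $a$ to the category of $\mathcal{F}$-internal actions of the underlying discrete precategory of $a$, that is, the functor $\mathsf{d}^{\mathcal{F}\circ a^{\mathrm{op}}}:\mathrm{lax}\text{-}\mathrm{Desc}(\mathcal{F}\circ a^{\mathrm{op}})\to\mathcal{F}(a(\mathsf{1}))$ that forgets descent data, creates absolute Kan extensions and, hence, in particular, creates absolute limits and colimits.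
   Context: $\mathrm{Cat}$ is the $2$-category of categories in some universe. The category $\Delta_3$: the subcategory of the category of finite nonempty ordinals and order-preserving maps with objects $\mathsf{1},\mathsf{2},\mathsf{3}$ generated by the maps $d^0,d^1:\mathsf{1}\to\mathsf{2}$, $s^0:\mathsf{2}\to\mathsf{1}$, $D^0,D^1,D^2:\mathsf{2}\to\mathsf{3}$ (the usual cofaces, $d^i$ and $D^i$ omitting $i$ from the image, and codegeneracy), subject to $s^0d^1=\mathrm{id}_{\mathsf{1}}=s^0d^0$ and $D^td^k=D^kd^{t-1}$ for $t>k$. A pseudofunctor $(\mathcal{A},\mathfrak{a}):\Delta_3\to\mathrm{Cat}$ has invertible natural transformations $\mathfrak{a}_{hg}:\mathcal{A}(h)\mathcal{A}(g)\Rightarrow\mathcal{A}(hg)$ and $\mathfrak{a}_x:\mathrm{id}_{\mathcal{A}(x)}\Rightarrow\mathcal{A}(\mathrm{id}_x)$ satisfying the usual coherence equations (similarly for pseudofunctors with any category as domain). Put $\mathcal{A}(\sigma_{01})=\mathfrak{a}_{D^0d^0}^{-1}\cdot\mathfrak{a}_{D^1d^0}$, $\mathcal{A}(\sigma_{02})=\mathfrak{a}_{D^0d^1}^{-1}\cdot\mathfrak{a}_{D^2d^0}$, $\mathcal{A}(\sigma_{12})=\mathfrak{a}_{D^1d^1}^{-1}\cdot\mathfrak{a}_{D^2d^1}$, $\mathcal{A}(\mathfrak{n}_0)=\mathfrak{a}_{\mathsf{1}}^{-1}\cdot\mathfrak{a}_{s^0d^0}$, $\mathcal{A}(\mathfrak{n}_1)=\mathfrak{a}_{\mathsf{1}}^{-1}\cdot\mathfrak{a}_{s^0d^1}$.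 Lax descent category $\mathrm{lax}\text{-}\mathrm{Desc}(\mathcal{A})$: objects are pairs $(w,\varphi)$ with $w$ an object of $\mathcal{A}(\mathsf{1})$ and $\varphi:\mathcal{A}(d^1)(w)\to\mathcal{A}(d^0)(w)$ a morphism of $\mathcal{A}(\mathsf{2})$ such that $\mathcal{A}(D^0)(\varphi)\cdot\mathcal{A}(\sigma_{02})_w\cdot\mathcal{A}(D^2)(\varphi)=\mathcal{A}(\sigma_{01})_w\cdot\mathcal{A}(D^1)(\varphi)\cdot\mathcal{A}(\sigma_{12})_w$ and $\mathcal{A}(\mathfrak{n}_0)_w\cdot\mathcal{A}(s^0)(\varphi)=\mathcal{A}(\mathfrak{n}_1)_w$. A morphism $(w,\varphi)\to(w',\varphi')$ is a morphism $m:w\to w'$ of $\mathcal{A}(\mathsf{1})$ with $\mathcal{A}(d^0)(m)\cdot\varphi=\varphi'\cdot\mathcal{A}(d^1)(m)$; composition is that of $\mathcal{A}(\mathsf{1})$. The forgetful functor $\mathsf{d}^{\mathcal{A}}:\mathrm{lax}\text{-}\mathrm{Desc}(\mathcal{A})\to\mathcal{A}(\mathsf{1})$ sends $(w,\varphi)\mapsto w$ and $m\mapsto m$. Internal actions: $a^{\mathrm{op}}:\Delta_3\to\mathbb{C}^{\mathrm{op}}$ is the dual functor of $a$, and $\mathcal{F}\circ a^{\mathrm{op}}:\Delta_3\to\mathrm{Cat}$ is the composite pseudofunctor, with structure cells $\mathfrak{f}_{a(x)}$ and $\mathfrak{f}_{a^{\mathrm{op}}(h)a^{\mathrm{op}}(g)}$.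 By definition $\mathcal{F}\text{-}\mathrm{IntAct}(a)=\mathrm{lax}\text{-}\mathrm{Desc}(\mathcal{F}\circ a^{\mathrm{op}})$. The underlying discrete precategory $\overline{a(\mathsf{1})}:\Delta_3^{\mathrm{op}}\to\mathbb{C}$ is the functor constantly equal to $a(\mathsf{1})$; its category of $\mathcal{F}$-internal actions is equivalent to, and here identified with, $\mathcal{F}(a(\mathsf{1}))$. Kan extensions (in $\mathrm{Cat}$): for functors $J:\mathtt{S}\to\mathtt{C}$ and $H:\mathtt{S}\to\mathtt{B}$, the right Kan extension of $J$ along $H$ is, if it exists, a pair $(\mathrm{Ran}_HJ:\mathtt{B}\to\mathtt{C},\ \gamma:(\mathrm{Ran}_HJ)H\Rightarrow J)$ such that for every $R:\mathtt{B}\to\mathtt{C}$ the map $\beta\mapsto\gamma\cdot(\beta*H)$ is a bijection from natural transformations $R\Rightarrow\mathrm{Ran}_HJ$ to natural transformations $RH\Rightarrow J$. A functor $G:\mathtt{C}\to\mathtt{D}$ preserves $(\hat J,\gamma)=\mathrm{Ran}_HJ$ if $(G\hat J,G*\gamma)$ is the right Kan extension of $GJ$ along $H$; it reflects the right Kan extension of $J$ along $H$ if, whenever $(G\hat J,G*\gamma)$ is the right Kan extension of $GJ$ along $H$, $(\hat J,\gamma)$ is the right Kan extension of $J$ along $H$. Assuming $\mathrm{Ran}_HGJ$ exists, $G$ creates it if $G$ reflects it and $\mathrm{Ran}_HJ$ exists and is preserved by $G$. Left Kan extensions and the corresponding notions are defined codually. A (right or left) Kan extension is absolute if it is preserved by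 every functor whose domain is its codomain category. $G$ creates absolute Kan extensions if, whenever $\mathrm{Ran}_HGJ$ (resp. $\mathrm{Lan}_HGJ$) is an absolute right (resp. left) Kan extension, $G$ creates it. Absolute limits (colimits) of diagrams indexed by a small category $\mathbb{S}$, and their creation, are the special case of right (left) Kan extensions along $H:\mathbb{S}\to\mathsf{1}$, with $\mathsf{1}$ the terminal category. *)

theory Defs
  imports Main "HOL-Library.FuncSet"
begin

section \<open>Categories, functors, natural transformations\<close>

record ('o, 'm) cat =
  Obj :: "'o set"
  Arr :: "'m set"
  Dom :: "'m \<Rightarrow> 'o"
  Cod :: "'m \<Rightarrow> 'o"
  Id :: "'o \<Rightarrow> 'm"
  Comp :: "'m \<Rightarrow> 'm \<Rightarrow> 'm"  \<comment> \<open>\<open>Comp C g f\<close> is \<open>g\<close> after \<open>f\<close>\<close>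

definition hom :: "('o, 'm) cat \<Rightarrow> 'o \<Rightarrow> 'o \<Rightarrow> 'm set" where
  "hom C x y = {f \<in> Arr C. Dom C f = x \<and> Cod C f = y}"

locale category =
  fixes C :: "('o, 'm) cat"
  assumes Dom_Obj: "f \<in> Arr C \<Longrightarrow> Dom C f \<in> Obj C"
    and Cod_Obj: "f \<in> Arr C \<Longrightarrow> Cod C f \<in> Obj C"
    and Id_hom: "x \<in> Obj C \<Longrightarrow> Id C x \<in> hom C x x"
    and Comp_hom: "f \<in> hom C x y \<Longrightarrow> g \<in> hom C y z \<Longrightarrow> Comp C g f \<in> hom C x z"
    and Comp_Id: "f \<in> hom C x y \<Longrightarrow> Comp C f (Id C x) = f"
    and Id_Comp: "f \<in> hom C x y \<Longrightarrow> Comp C (Id C y) f = f"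
    and Comp_assoc: "f \<in> hom C w x \<Longrightarrow> g \<in> hom C x y \<Longrightarrow> h \<in> hom C y z \<Longrightarrow>
        Comp C h (Comp C g f) = Comp C (Comp C h g) f"

definition inverse_arrows :: "('o, 'm) cat \<Rightarrow> 'm \<Rightarrow> 'm \<Rightarrow> bool" where
  "inverse_arrows C f g \<longleftrightarrow> f \<in> Arr C \<and> g \<in> hom C (Cod C f) (Dom C f) \<and>
     Comp C g f = Id C (Dom C f) \<and> Comp C f g = Id C (Cod C f)"

definition is_iso :: "('o, 'm) cat \<Rightarrow> 'm \<Rightarrow> bool" where
  "is_iso C f \<longleftrightarrow> (\<exists>g. inverse_arrows C f g)"

definition inv_arr :: "('o, 'm) cat \<Rightarrow> 'm \<Rightarrow> 'm" where
  "inv_arr C f = (THE g. inverse_arrows C f g)"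

definition op_cat :: "('o, 'm) cat \<Rightarrow> ('o, 'm) cat" where
  "op_cat C = \<lparr>Obj = Obj C, Arr = Arr C, Dom = Cod C, Cod = Dom C, Id = Id C,
     Comp = (\<lambda>g f. Comp C f g)\<rparr>"

definition terminal_cat :: "(unit, unit) cat" where
  "terminal_cat = \<lparr>Obj = UNIV, Arr = UNIV, Dom = (\<lambda>_. ()), Cod = (\<lambda>_. ()), Id = (\<lambda>_. ()),
     Comp = (\<lambda>_ _. ())\<rparr>"

text \<open>The values of a functor outside the carriers of its domain are irrelevant.\<close>

record ('o1, 'm1, 'o2, 'm2) fun_data =
  fobj :: "'o1 \<Rightarrow> 'o2"
  farr :: "'m1 \<Rightarrow> 'm2"

locale is_functor = B: category B + C: category C
  for B :: "('o1, 'm1) cat" and C :: "('o2, 'm2) cat" +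
  fixes F :: "('o1, 'm1, 'o2, 'm2) fun_data"
  assumes F_Obj: "x \<in> Obj B \<Longrightarrow> fobj F x \<in> Obj C"
    and F_hom: "f \<in> hom B x y \<Longrightarrow> farr F f \<in> hom C (fobj F x) (fobj F y)"
    and F_Id: "x \<in> Obj B \<Longrightarrow> farr F (Id B x) = Id C (fobj F x)"
    and F_Comp: "f \<in> hom B x y \<Longrightarrow> g \<in> hom B y z \<Longrightarrow>
        farr F (Comp B g f) = Comp C (farr F g) (farr F f)"

definition id_fun :: "('o, 'm, 'o, 'm) fun_data" where
  "id_fun = \<lparr>fobj = id, farr = id\<rparr>"

definition comp_fun ::
  "('o2, 'm2, 'o3, 'm3) fun_data \<Rightarrow> ('o1, 'm1, 'o2, 'm2) fun_data \<Rightarrow> ('o1, 'm1, 'o3, 'm3) fun_data"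
  (infixr "\<circ>\<^sub>F" 55) where
  "G \<circ>\<^sub>F F = \<lparr>fobj = fobj G \<circ> fobj F, farr = farr G \<circ> farr F\<rparr>"

definition to_terminal :: "('o, 'm, unit, unit) fun_data" where
  "to_terminal = \<lparr>fobj = (\<lambda>_. ()), farr = (\<lambda>_. ())\<rparr>"

text \<open>The dual \<open>op_fun F : op_cat B \<rightarrow> op_cat C\<close> of \<open>F : B \<rightarrow> C\<close> has the same object and arrow
  maps as \<open>F\<close>.\<close>

definition op_fun :: "('o1, 'm1, 'o2, 'm2) fun_data \<Rightarrow> ('o1, 'm1, 'o2, 'm2) fun_data" where
  "op_fun F = F"

lemma category_op_cat: "category C \<Longrightarrow> category (op_cat C)"
  by (auto simp: category_def op_cat_def hom_def)

lemma op_cat_op_cat: "op_cat (op_cat C) = C"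
  by (simp add: op_cat_def)

lemma is_functor_op_fun:
  assumes "is_functor B C F"
  shows "is_functor (op_cat B) (op_cat C) (op_fun F)"
  using assms category_op_cat[of B] category_op_cat[of C]
  by (auto simp: is_functor_def is_functor_axioms_def op_fun_def hom_def) 
    (auto simp: op_cat_def hom_def)

text \<open>Natural transformations are required to be \<^const>\<open>extensional\<close>, so that two of them are equal
  as soon as their components at the objects of the domain agree.\<close>

definition nat_trans ::
  "('o1, 'm1) cat \<Rightarrow> ('o2, 'm2) cat \<Rightarrow> ('o1, 'm1, 'o2, 'm2) fun_data \<Rightarrow>
     ('o1, 'm1, 'o2, 'm2) fun_data \<Rightarrow> ('o1 \<Rightarrow> 'm2) \<Rightarrow> bool" where
  "nat_trans B C F G \<alpha> \<longleftrightarrow>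
     \<alpha> \<in> extensional (Obj B) \<and>
     (\<forall>x\<in>Obj B. \<alpha> x \<in> hom C (fobj F x) (fobj G x)) \<and>
     (\<forall>x y. \<forall>f\<in>hom B x y. Comp C (\<alpha> y) (farr F f) = Comp C (farr G f) (\<alpha> x))"

definition nat_iso ::
  "('o1, 'm1) cat \<Rightarrow> ('o2, 'm2) cat \<Rightarrow> ('o1, 'm1, 'o2, 'm2) fun_data \<Rightarrow>
     ('o1, 'm1, 'o2, 'm2) fun_data \<Rightarrow> ('o1 \<Rightarrow> 'm2) \<Rightarrow> bool" where
  "nat_iso B C F G \<alpha> \<longleftrightarrow> nat_trans B C F G \<alpha> \<and> (\<forall>x\<in>Obj B. is_iso C (\<alpha> x))"

definition vcomp ::
  "('o1, 'm1) cat \<Rightarrow> ('o2, 'm2) cat \<Rightarrow> ('o1 \<Rightarrow> 'm2) \<Rightarrow> ('o1 \<Rightarrow> 'm2) \<Rightarrow> 'o1 \<Rightarrow> 'm2" where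
  "vcomp B C \<beta> \<alpha> = (\<lambda>x\<in>Obj B. Comp C (\<beta> x) (\<alpha> x))"

text \<open>For \<open>H : S \<rightarrow> B\<close> and \<open>\<beta>\<close> between functors on \<open>B\<close>, \<open>whisker_r S \<beta> H\<close> is \<open>\<beta> * H\<close>;
  for \<open>\<gamma>\<close> between functors on \<open>S\<close>, \<open>whisker_l S G \<gamma>\<close> is \<open>G * \<gamma>\<close>.\<close>

definition whisker_r ::
  "('o1, 'm1) cat \<Rightarrow> ('o2 \<Rightarrow> 'm3) \<Rightarrow> ('o1, 'm1, 'o2, 'm2) fun_data \<Rightarrow> 'o1 \<Rightarrow> 'm3" where
  "whisker_r S \<beta> H = (\<lambda>s\<in>Obj S. \<beta> (fobj H s))"

definition whisker_l ::
  "('o1, 'm1) cat \<Rightarrow> ('o2, 'm2, 'o3, 'm3) fun_data \<Rightarrow> ('o1 \<Rightarrow> 'm2) \<Rightarrow> 'o1 \<Rightarrow> 'm3" where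
  "whisker_l S G \<gamma> = (\<lambda>s\<in>Obj S. farr G (\<gamma> s))"


section \<open>Pseudofunctors from a category to Cat\<close>

text \<open>Cat is the 2-category of all categories whose objects and arrows are taken from two fixed
  types, which play the role of the universe. \<open>PComp P h g\<close> is the cell \<open>P(h) P(g) \<Rightarrow> P(h g)\<close> and
  \<open>PUnit P x\<close> the cell \<open>id \<Rightarrow> P(id\<^sub>x)\<close>.\<close>

record ('c, 'd, 'o, 'm) pfun_data =
  PObj :: "'c \<Rightarrow> ('o, 'm) cat"
  PArr :: "'d \<Rightarrow> ('o, 'm, 'o, 'm) fun_data"
  PComp :: "'d \<Rightarrow> 'd \<Rightarrow> 'o \<Rightarrow> 'm"
  PUnit :: "'c \<Rightarrow> 'o \<Rightarrow> 'm"

locale pseudofunctor = category X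
  for X :: "('c, 'd) cat" +
  fixes P :: "('c, 'd, 'o, 'm) pfun_data"
  assumes P_Obj: "x \<in> Obj X \<Longrightarrow> category (PObj P x)"
    and P_Arr: "f \<in> hom X x y \<Longrightarrow> is_functor (PObj P x) (PObj P y) (PArr P f)"
    and P_Comp: "g \<in> hom X x y \<Longrightarrow> h \<in> hom X y z \<Longrightarrow>
        nat_iso (PObj P x) (PObj P z) (PArr P h \<circ>\<^sub>F PArr P g) (PArr P (Comp X h g)) (PComp P h g)"
    and P_Unit: "x \<in> Obj X \<Longrightarrow>
        nat_iso (PObj P x) (PObj P x) id_fun (PArr P (Id X x)) (PUnit P x)"
    and P_assoc: "f \<in> hom X w x \<Longrightarrow> g \<in> hom X x y \<Longrightarrow> h \<in> hom X y z \<Longrightarrow> u \<in> Obj (PObj P w) \<Longrightarrow>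
        Comp (PObj P z) (PComp P (Comp X h g) f u) (PComp P h g (fobj (PArr P f) u)) =
        Comp (PObj P z) (PComp P h (Comp X g f) u) (farr (PArr P h) (PComp P g f u))"
    and P_unit_r: "f \<in> hom X x y \<Longrightarrow> u \<in> Obj (PObj P x) \<Longrightarrow>
        Comp (PObj P y) (PComp P f (Id X x) u) (farr (PArr P f) (PUnit P x u)) =
        Id (PObj P y) (fobj (PArr P f) u)"
    and P_unit_l: "f \<in> hom X x y \<Longrightarrow> u \<in> Obj (PObj P x) \<Longrightarrow>
        Comp (PObj P y) (PComp P (Id X y) f u) (PUnit P y (fobj (PArr P f) u)) =
        Id (PObj P y) (fobj (PArr P f) u)"

definition pfun_comp_fun ::
  "('c, 'd, 'o, 'm) pfun_data \<Rightarrow> ('c1, 'd1, 'c, 'd) fun_data \<Rightarrow> ('c1, 'd1, 'o, 'm) pfun_data"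
  (infixr "\<circ>\<^sub>P" 55) where
  "P \<circ>\<^sub>P a = \<lparr>PObj = (\<lambda>x. PObj P (fobj a x)), PArr = (\<lambda>h. PArr P (farr a h)),
     PComp = (\<lambda>h g. PComp P (farr a h) (farr a g)), PUnit = (\<lambda>x. PUnit P (fobj a x))\<rparr>"

lemma pseudofunctor_pfun_comp_fun:
  assumes P: "pseudofunctor Y P" and a: "is_functor X Y a"
  shows "pseudofunctor X (P \<circ>\<^sub>P a)"
proof -
  interpret P: pseudofunctor Y P by (rule P)
  interpret a: is_functor X Y a by (rule a)
  have e: "PObj (P \<circ>\<^sub>P a) x = PObj P (fobj a x)" "PArr (P \<circ>\<^sub>P a) f = PArr P (farr a f)"
     "PComp (P \<circ>\<^sub>P a) h f = PComp P (farr a h) (farr a f)" 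
     "PUnit (P \<circ>\<^sub>P a) x = PUnit P (fobj a x)" for x f h
    by (simp_all add: pfun_comp_fun_def)
  show ?thesis
  proof (intro pseudofunctor.intro pseudofunctor_axioms.intro)
    show "category X" by unfold_locales
  next
    fix f g h w x y z u
    assume *: "f \<in> hom X w x" "g \<in> hom X x y" "h \<in> hom X y z" "u \<in> Obj (PObj (P \<circ>\<^sub>P a) w)"
    show "Comp (PObj (P \<circ>\<^sub>P a) z) (PComp (P \<circ>\<^sub>P a) (Comp X h g) f u) (PComp (P \<circ>\<^sub>P a) h g (fobj (PArr (P \<circ>\<^sub>P a) f) u)) =
        Comp (PObj (P \<circ>\<^sub>P a) z) (PComp (P \<circ>\<^sub>P a) h (Comp X g f) u) (farr (PArr (P \<circ>\<^sub>P a) h) (PComp (P \<circ>\<^sub>P a) g f u))"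
      using P.P_assoc[OF a.F_hom[OF *(1)] a.F_hom[OF *(2)] a.F_hom[OF *(3)], of u] *
      by (simp add: e a.F_Comp)
  next
    fix f x y u assume *: "f \<in> hom X x y" "u \<in> Obj (PObj (P \<circ>\<^sub>P a) x)"
    then have "x \<in> Obj X" "y \<in> Obj X" by (auto simp: hom_def a.B.Dom_Obj a.B.Cod_Obj)
    with * show "Comp (PObj (P \<circ>\<^sub>P a) y) (PComp (P \<circ>\<^sub>P a) f (Id X x) u) (farr (PArr (P \<circ>\<^sub>P a) f) (PUnit (P \<circ>\<^sub>P a) x u)) =
        Id (PObj (P \<circ>\<^sub>P a) y) (fobj (PArr (P \<circ>\<^sub>P a) f) u)"
     "Comp (PObj (P \<circ>\<^sub>P a) y) (PComp (P \<circ>\<^sub>P a) (Id X y) f u) (PUnit (P \<circ>\<^sub>P a) y (fobj (PArr (P \<circ>\<^sub>P a) f) u)) =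
        Id (PObj (P \<circ>\<^sub>P a) y) (fobj (PArr (P \<circ>\<^sub>P a) f) u)"
      using P.P_unit_r[OF a.F_hom[OF *(1)], of u] P.P_unit_l[OF a.F_hom[OF *(1)], of u]
      by (simp_all add: e a.F_Id)
  next
    fix g h x y z assume *: "g \<in> hom X x y" "h \<in> hom X y z"
    show "nat_iso (PObj (P \<circ>\<^sub>P a) x) (PObj (P \<circ>\<^sub>P a) z) (PArr (P \<circ>\<^sub>P a) h \<circ>\<^sub>F PArr (P \<circ>\<^sub>P a) g) (PArr (P \<circ>\<^sub>P a) (Comp X h g)) (PComp (P \<circ>\<^sub>P a) h g)"
      using P.P_Comp[OF a.F_hom[OF *(1)] a.F_hom[OF *(2)]] * by (simp add: e a.F_Comp)
  next
    fix x assume *: "x \<in> Obj X"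
    show "nat_iso (PObj (P \<circ>\<^sub>P a) x) (PObj (P \<circ>\<^sub>P a) x) id_fun (PArr (P \<circ>\<^sub>P a) (Id X x)) (PUnit (P \<circ>\<^sub>P a) x)"
      using P.P_Unit[OF a.F_Obj[OF *]] * by (simp add: e a.F_Id)
  qed (auto simp: e P.P_Obj a.F_Obj intro: P.P_Arr a.F_hom)
qed


section \<open>The category \<open>\<Delta>\<^sub>3\<close>\<close>

text \<open>The ordinal \<open>n\<close> is \<open>{..<n}\<close>; an arrow \<open>n \<rightarrow> m\<close> is a triple \<open>(n, f, m)\<close> with \<open>f\<close> extensional.\<close>

definition finord :: "(nat, nat \<times> (nat \<Rightarrow> nat) \<times> nat) cat" where
  "finord = \<lparr>Obj = {n. 0 < n},
     Arr = {(n, f, m). 0 < n \<and> 0 < m \<and> f \<in> {..<n} \<rightarrow>\<^sub>E {..<m} \<and> mono_on {..<n} f},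
     Dom = (\<lambda>(n, f, m). n), Cod = (\<lambda>(n, f, m). m),
     Id = (\<lambda>n. (n, (\<lambda>j\<in>{..<n}. j), n)),
     Comp = (\<lambda>(m', g, k) (n, f, m). (n, compose {..<n} g f, k))\<rparr>"

definition coface :: "nat \<Rightarrow> nat \<Rightarrow> nat \<times> (nat \<Rightarrow> nat) \<times> nat" where
  "coface n i = (n, (\<lambda>j\<in>{..<n}. if j < i then j else Suc j), Suc n)"

definition dd :: "nat \<Rightarrow> nat \<times> (nat \<Rightarrow> nat) \<times> nat" where "dd i = coface 1 i"

definition DD :: "nat \<Rightarrow> nat \<times> (nat \<Rightarrow> nat) \<times> nat" where "DD i = coface 2 i"

definition s0 :: "nat \<times> (nat \<Rightarrow> nat) \<times> nat" where
  "s0 = (2, (\<lambda>j\<in>{..<2}. 0), 1)"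

inductive_set Delta3_arrows :: "(nat \<times> (nat \<Rightarrow> nat) \<times> nat) set" where
  gen_Id: "n \<in> {1, 2, 3} \<Longrightarrow> Id finord n \<in> Delta3_arrows"
| gen_d: "i \<in> {0, 1} \<Longrightarrow> dd i \<in> Delta3_arrows"
| gen_s0: "s0 \<in> Delta3_arrows"
| gen_D: "i \<in> {0, 1, 2} \<Longrightarrow> DD i \<in> Delta3_arrows"
| gen_Comp: "f \<in> Delta3_arrows \<Longrightarrow> g \<in> Delta3_arrows \<Longrightarrow> Cod finord f = Dom finord g \<Longrightarrow>
    Comp finord g f \<in> Delta3_arrows"

definition Delta3 :: "(nat, nat \<times> (nat \<Rightarrow> nat) \<times> nat) cat" where
  "Delta3 = finord\<lparr>Obj := {1, 2, 3}, Arr := Delta3_arrows\<rparr>"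

lemma category_finord: "category finord"
proof
  fix f assume "f \<in> Arr finord" then show "Dom finord f \<in> Obj finord"
    by (auto simp: finord_def)
next
  fix f assume "f \<in> Arr finord" then show "Cod finord f \<in> Obj finord"
    by (auto simp: finord_def)
next
  fix x assume "x \<in> Obj finord" then show "Id finord x \<in> hom finord x x"
    by (auto simp: finord_def hom_def mono_on_def)
next
  fix f g x y z assume "f \<in> hom finord x y" "g \<in> hom finord y z"
  then show "Comp finord g f \<in> hom finord x z"
    by (auto simp: finord_def hom_def mono_on_def compose_def PiE_def Pi_def)
next
  fix f x y assume "f \<in> hom finord x y"
  then show "Comp finord f (Id finord x) = f" "Comp finord (Id finord y) f = f"
    by (auto simp: finord_def hom_def compose_def PiE_def Pi_def fun_eq_iff extensional_def)
next
  fix f g h w x y z assume "f \<in> hom finord w x" "g \<in> hom finord x y" "h \<in> hom finord y z"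
  then show "Comp finord h (Comp finord g f) = Comp finord (Comp finord h g) f"
    by (auto simp: finord_def hom_def compose_def PiE_def Pi_def fun_eq_iff)
qed

lemma Delta3_arrows_finord:
  "f \<in> Delta3_arrows \<Longrightarrow> f \<in> Arr finord \<and> Dom finord f \<in> {1,2,3} \<and> Cod finord f \<in> {1,2,3}"
proof (induction rule: Delta3_arrows.induct)
  case (gen_Comp f g)
  then have "Comp finord g f \<in> hom finord (Dom finord f) (Cod finord g)"
    by (intro category.Comp_hom[OF category_finord]) (auto simp: hom_def)
  with gen_Comp show ?case by (auto simp: hom_def)
qed (auto simp: finord_def dd_def DD_def coface_def s0_def mono_on_def)

lemma category_Delta3: "category Delta3"
proof -
  have h: "f \<in> hom Delta3 x y \<longleftrightarrow> f \<in> hom finord x y \<and> f \<in> Delta3_arrows" for f x y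
    using Delta3_arrows_finord[of f] by (auto simp: Delta3_def hom_def)
  have e: "Comp Delta3 = Comp finord" "Id Delta3 = Id finord" "Dom Delta3 = Dom finord"
    "Cod Delta3 = Cod finord" "Obj Delta3 = {1,2,3}" "Arr Delta3 = Delta3_arrows"
    by (simp_all add: Delta3_def)
  interpret category finord by (rule category_finord)
  show ?thesis
  proof
    fix x assume "x \<in> Obj Delta3" 
    then show "Id Delta3 x \<in> hom Delta3 x x"
      using Id_hom[of x] gen_Id[of x] by (auto simp: h e) (auto simp: finord_def)
  next
    fix f g x y z assume "f \<in> hom Delta3 x y" "g \<in> hom Delta3 y z"
    then show "Comp Delta3 g f \<in> hom Delta3 x z"
      using Comp_hom[of f x y g z] gen_Comp[of f g] by (simp add: h e) (simp add: hom_def)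
  qed (use Delta3_arrows_finord Comp_Id Id_Comp Comp_assoc in \<open>auto simp: h e\<close>)
qed

lemma Delta3_hom:
  "i \<in> {0,1} \<Longrightarrow> dd i \<in> hom Delta3 1 2" "s0 \<in> hom Delta3 2 1" "i \<in> {0,1,2} \<Longrightarrow> DD i \<in> hom Delta3 2 3"
  by (auto simp: Delta3_def hom_def intro: gen_s0 gen_d[simplified] gen_D[simplified])
   (auto simp: finord_def dd_def DD_def coface_def s0_def)

lemma Delta3_relations:
  "Comp Delta3 s0 (dd 0) = Id Delta3 1"
  "Comp Delta3 s0 (dd 1) = Id Delta3 1"
  "Comp Delta3 (DD 1) (dd 0) = Comp Delta3 (DD 0) (dd 0)"
  "Comp Delta3 (DD 2) (dd 0) = Comp Delta3 (DD 0) (dd 1)"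
  "Comp Delta3 (DD 2) (dd 1) = Comp Delta3 (DD 1) (dd 1)"
  by (auto simp: Delta3_def finord_def dd_def DD_def coface_def s0_def compose_def fun_eq_iff)


section \<open>The lax descent category\<close>

type_synonym ('o, 'm) desc_data = "(nat, nat \<times> (nat \<Rightarrow> nat) \<times> nat, 'o, 'm) pfun_data"

definition \<sigma>01 :: "('o, 'm) desc_data \<Rightarrow> 'o \<Rightarrow> 'm" where
  "\<sigma>01 A w = Comp (PObj A 3) (inv_arr (PObj A 3) (PComp A (DD 0) (dd 0) w)) (PComp A (DD 1) (dd 0) w)"

definition \<sigma>02 :: "('o, 'm) desc_data \<Rightarrow> 'o \<Rightarrow> 'm" where
  "\<sigma>02 A w = Comp (PObj A 3) (inv_arr (PObj A 3) (PComp A (DD 0) (dd 1) w)) (PComp A (DD 2) (dd 0) w)"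

definition \<sigma>12 :: "('o, 'm) desc_data \<Rightarrow> 'o \<Rightarrow> 'm" where
  "\<sigma>12 A w = Comp (PObj A 3) (inv_arr (PObj A 3) (PComp A (DD 1) (dd 1) w)) (PComp A (DD 2) (dd 1) w)"

definition \<nn>0 :: "('o, 'm) desc_data \<Rightarrow> 'o \<Rightarrow> 'm" where
  "\<nn>0 A w = Comp (PObj A 1) (inv_arr (PObj A 1) (PUnit A 1 w)) (PComp A s0 (dd 0) w)"

definition \<nn>1 :: "('o, 'm) desc_data \<Rightarrow> 'o \<Rightarrow> 'm" where
  "\<nn>1 A w = Comp (PObj A 1) (inv_arr (PObj A 1) (PUnit A 1 w)) (PComp A s0 (dd 1) w)"

definition lax_desc_obj :: "('o, 'm) desc_data \<Rightarrow> ('o \<times> 'm) set" where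
  "lax_desc_obj A = {(w, \<phi>).
     w \<in> Obj (PObj A 1) \<and>
     \<phi> \<in> hom (PObj A 2) (fobj (PArr A (dd 1)) w) (fobj (PArr A (dd 0)) w) \<and>
     Comp (PObj A 3) (farr (PArr A (DD 0)) \<phi>)
       (Comp (PObj A 3) (\<sigma>02 A w) (farr (PArr A (DD 2)) \<phi>)) =
     Comp (PObj A 3) (\<sigma>01 A w)
       (Comp (PObj A 3) (farr (PArr A (DD 1)) \<phi>) (\<sigma>12 A w)) \<and>
     Comp (PObj A 1) (\<nn>0 A w) (farr (PArr A s0) \<phi>) = \<nn>1 A w}"

text \<open>An arrow \<open>m : (w, \<phi>) \<rightarrow> (w', \<phi>')\<close> is stored together with its source and target.\<close>

definition lax_desc ::
  "('o, 'm) desc_data \<Rightarrow> ('o \<times> 'm, ('o \<times> 'm) \<times> 'm \<times> ('o \<times> 'm)) cat" where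
  "lax_desc A = \<lparr>Obj = lax_desc_obj A,
     Arr = {((w, \<phi>), m, (w', \<phi>')).
       (w, \<phi>) \<in> lax_desc_obj A \<and> (w', \<phi>') \<in> lax_desc_obj A \<and> m \<in> hom (PObj A 1) w w' \<and>
       Comp (PObj A 2) (farr (PArr A (dd 0)) m) \<phi> = Comp (PObj A 2) \<phi>' (farr (PArr A (dd 1)) m)},
     Dom = (\<lambda>(p, m, q). p), Cod = (\<lambda>(p, m, q). q),
     Id = (\<lambda>(w, \<phi>). ((w, \<phi>), Id (PObj A 1) w, (w, \<phi>))),
     Comp = (\<lambda>(p', m', q') (p, m, q). (p, Comp (PObj A 1) m' m, q'))\<rparr>"

definition forget_desc ::
  "('o, 'm) desc_data \<Rightarrow> ('o \<times> 'm, ('o \<times> 'm) \<times> 'm \<times> ('o \<times> 'm), 'o, 'm) fun_data" where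
  "forget_desc A = \<lparr>fobj = fst, farr = (\<lambda>(p, m, q). m)\<rparr>"

text \<open>The category of \<open>\<F>\<close>-internal actions of a precategory \<open>a : \<Delta>\<^sub>3\<^sup>o\<^sup>p \<rightarrow> \<CC>\<close>.\<close>

definition IntAct ::
  "('c, 'd, 'o, 'm) pfun_data \<Rightarrow> (nat, nat \<times> (nat \<Rightarrow> nat) \<times> nat, 'c, 'd) fun_data \<Rightarrow>
     ('o \<times> 'm, ('o \<times> 'm) \<times> 'm \<times> ('o \<times> 'm)) cat" where
  "IntAct F a = lax_desc (F \<circ>\<^sub>P op_fun a)"

lemma category_lax_desc:
  assumes "pseudofunctor Delta3 A"
  shows "category (lax_desc A)"
proof -
  interpret A: pseudofunctor Delta3 A by (rule assms)
  interpret A1: category "PObj A 1" using A.P_Obj by (simp add: Delta3_def)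
  interpret A2: category "PObj A 2" using A.P_Obj by (simp add: Delta3_def)
  interpret d0: is_functor "PObj A 1" "PObj A 2" "PArr A (dd 0)"
    using A.P_Arr Delta3_hom by simp
  interpret d1: is_functor "PObj A 1" "PObj A 2" "PArr A (dd 1)"
    using A.P_Arr Delta3_hom by simp
  have obj: "w \<in> Obj (PObj A 1)"
    "\<phi> \<in> hom (PObj A 2) (fobj (PArr A (dd 1)) w) (fobj (PArr A (dd 0)) w)"
    if "(w, \<phi>) \<in> lax_desc_obj A" for w \<phi>
    using that by (auto simp: lax_desc_obj_def)
  have hom_iff: "f \<in> hom (lax_desc A) p q \<longleftrightarrow> (\<exists>m. f = (p, m, q) \<and> p \<in> lax_desc_obj A \<and> q \<in> lax_desc_obj A \<and>
     m \<in> hom (PObj A 1) (fst p) (fst q) \<and>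
     Comp (PObj A 2) (farr (PArr A (dd 0)) m) (snd p) = Comp (PObj A 2) (snd q) (farr (PArr A (dd 1)) m))"
    for f p q by (auto simp: hom_def lax_desc_def split: prod.splits)
  show ?thesis
  proof
    fix x assume "x \<in> Obj (lax_desc A)"
    then show "Id (lax_desc A) x \<in> hom (lax_desc A) x x"
      unfolding hom_iff using obj[of "fst x" "snd x"]
      by (auto simp: lax_desc_def split: prod.splits
         simp: A1.Id_hom d0.F_Id d1.F_Id A2.Id_Comp A2.Comp_Id simp del: One_nat_def)
  next
    fix f g p q r assume "f \<in> hom (lax_desc A) p q" "g \<in> hom (lax_desc A) q r"
    then obtain m n where f: "f = (p, m, q)" "m \<in> hom (PObj A 1) (fst p) (fst q)"
      "Comp (PObj A 2) (farr (PArr A (dd 0)) m) (snd p) = Comp (PObj A 2) (snd q) (farr (PArr A (dd 1)) m)"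
      and g: "g = (q, n, r)" "n \<in> hom (PObj A 1) (fst q) (fst r)"
      "Comp (PObj A 2) (farr (PArr A (dd 0)) n) (snd q) = Comp (PObj A 2) (snd r) (farr (PArr A (dd 1)) n)"
      and o: "p \<in> lax_desc_obj A" "q \<in> lax_desc_obj A" "r \<in> lax_desc_obj A"
      by (auto simp: hom_iff)
    let ?c = "Comp (PObj A 2)" and ?f0 = "farr (PArr A (dd 0))" and ?f1 = "farr (PArr A (dd 1))"
    have p: "snd p \<in> hom (PObj A 2) (fobj (PArr A (dd 1)) (fst p)) (fobj (PArr A (dd 0)) (fst p))"
      and q: "snd q \<in> hom (PObj A 2) (fobj (PArr A (dd 1)) (fst q)) (fobj (PArr A (dd 0)) (fst q))"
      and r: "snd r \<in> hom (PObj A 2) (fobj (PArr A (dd 1)) (fst r)) (fobj (PArr A (dd 0)) (fst r))"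
      using o obj(2)[of "fst p" "snd p"] obj(2)[of "fst q" "snd q"] obj(2)[of "fst r" "snd r"]
      by simp_all
    have "?c (?f0 (Comp (PObj A 1) n m)) (snd p) = ?c (?c (?f0 n) (?f0 m)) (snd p)"
      by (simp only: d0.F_Comp[OF f(2) g(2)])
    also have "\<dots> = ?c (?f0 n) (?c (?f0 m) (snd p))"
      by (rule A2.Comp_assoc[OF p d0.F_hom[OF f(2)] d0.F_hom[OF g(2)], symmetric])
    also have "\<dots> = ?c (?c (?f0 n) (snd q)) (?f1 m)"
      by (simp only: f(3) A2.Comp_assoc[OF d1.F_hom[OF f(2)] q d0.F_hom[OF g(2)]])
    also have "\<dots> = ?c (snd r) (?c (?f1 n) (?f1 m))"
      by (simp only: g(3) A2.Comp_assoc[OF d1.F_hom[OF f(2)] d1.F_hom[OF g(2)] r])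
    also have "\<dots> = ?c (snd r) (?f1 (Comp (PObj A 1) n m))"
      by (simp only: d1.F_Comp[OF f(2) g(2)])
    finally have "?c (?f0 (Comp (PObj A 1) n m)) (snd p) = ?c (snd r) (?f1 (Comp (PObj A 1) n m))" .
    with f g o A1.Comp_hom[OF f(2) g(2)] show "Comp (lax_desc A) g f \<in> hom (lax_desc A) p r"
      unfolding hom_iff by (auto simp: lax_desc_def)
  next
    fix f p q assume "f \<in> hom (lax_desc A) p q"
    then show "Comp (lax_desc A) f (Id (lax_desc A) p) = f" "Comp (lax_desc A) (Id (lax_desc A) q) f = f"
      unfolding hom_iff by (auto simp: lax_desc_def A1.Comp_Id A1.Id_Comp split: prod.splits simp del: One_nat_def)
  next
    fix f g h w x y z assume "f \<in> hom (lax_desc A) w x" "g \<in> hom (lax_desc A) x y" "h \<in> hom (lax_desc A) y z"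
    then show "Comp (lax_desc A) h (Comp (lax_desc A) g f) = Comp (lax_desc A) (Comp (lax_desc A) h g) f"
      unfolding hom_iff by (auto simp: lax_desc_def A1.Comp_assoc split: prod.splits simp del: One_nat_def)
  qed (auto simp: lax_desc_def)
qed

lemma is_functor_forget_desc:
  assumes "pseudofunctor Delta3 A"
  shows "is_functor (lax_desc A) (PObj A 1) (forget_desc A)"
proof -
  interpret A: pseudofunctor Delta3 A by (rule assms)
  have "category (PObj A 1)" using A.P_Obj by (simp add: Delta3_def)
  then show ?thesis
    unfolding is_functor_def is_functor_axioms_def
    by (intro conjI category_lax_desc assms)
      (auto simp: hom_def lax_desc_def forget_desc_def lax_desc_obj_def)
qed

lemma is_functor_forget_IntAct:
  assumes "pseudofunctor (op_cat C) F" and "is_functor (op_cat Delta3) C a"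
  shows "is_functor (IntAct F a) (PObj F (fobj a 1)) (forget_desc (F \<circ>\<^sub>P op_fun a))"
proof -
  have "pseudofunctor Delta3 (F \<circ>\<^sub>P op_fun a)"
    using pseudofunctor_pfun_comp_fun[OF assms(1)] is_functor_op_fun[OF assms(2)]
    by (simp add: op_cat_op_cat)
  from is_functor_forget_desc[OF this] show ?thesis
    by (simp add: IntAct_def pfun_comp_fun_def op_fun_def)
qed


section \<open>Kan extensions\<close>

definition is_ran ::
  "('so, 'sm) cat \<Rightarrow> ('bo, 'bm) cat \<Rightarrow> ('co, 'cm) cat \<Rightarrow> ('so, 'sm, 'bo, 'bm) fun_data \<Rightarrow>
     ('so, 'sm, 'co, 'cm) fun_data \<Rightarrow> ('bo, 'bm, 'co, 'cm) fun_data \<Rightarrow> ('so \<Rightarrow> 'cm) \<Rightarrow> bool" where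
  "is_ran S B C H J K \<gamma> \<longleftrightarrow>
     is_functor B C K \<and> nat_trans S C (K \<circ>\<^sub>F H) J \<gamma> \<and>
     (\<forall>R. is_functor B C R \<longrightarrow>
        bij_betw (\<lambda>\<beta>. vcomp S C \<gamma> (whisker_r S \<beta> H))
          {\<beta>. nat_trans B C R K \<beta>} {\<tau>. nat_trans S C (R \<circ>\<^sub>F H) J \<tau>})"

definition is_lan ::
  "('so, 'sm) cat \<Rightarrow> ('bo, 'bm) cat \<Rightarrow> ('co, 'cm) cat \<Rightarrow> ('so, 'sm, 'bo, 'bm) fun_data \<Rightarrow>
     ('so, 'sm, 'co, 'cm) fun_data \<Rightarrow> ('bo, 'bm, 'co, 'cm) fun_data \<Rightarrow> ('so \<Rightarrow> 'cm) \<Rightarrow> bool" where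
  "is_lan S B C H J K \<eta> \<longleftrightarrow>
     is_functor B C K \<and> nat_trans S C J (K \<circ>\<^sub>F H) \<eta> \<and>
     (\<forall>R. is_functor B C R \<longrightarrow>
        bij_betw (\<lambda>\<beta>. vcomp S C (whisker_r S \<beta> H) \<eta>)
          {\<beta>. nat_trans B C K R \<beta>} {\<tau>. nat_trans S C J (R \<circ>\<^sub>F H) \<tau>})"

definition preserves_ran ::
  "('so, 'sm) cat \<Rightarrow> ('bo, 'bm) cat \<Rightarrow> ('do, 'dm) cat \<Rightarrow> ('so, 'sm, 'bo, 'bm) fun_data \<Rightarrow>
     ('so, 'sm, 'co, 'cm) fun_data \<Rightarrow> ('bo, 'bm, 'co, 'cm) fun_data \<Rightarrow> ('so \<Rightarrow> 'cm) \<Rightarrow>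
     ('co, 'cm, 'do, 'dm) fun_data \<Rightarrow> bool" where
  "preserves_ran S B D H J K \<gamma> G \<longleftrightarrow> is_ran S B D H (G \<circ>\<^sub>F J) (G \<circ>\<^sub>F K) (whisker_l S G \<gamma>)"

definition preserves_lan ::
  "('so, 'sm) cat \<Rightarrow> ('bo, 'bm) cat \<Rightarrow> ('do, 'dm) cat \<Rightarrow> ('so, 'sm, 'bo, 'bm) fun_data \<Rightarrow>
     ('so, 'sm, 'co, 'cm) fun_data \<Rightarrow> ('bo, 'bm, 'co, 'cm) fun_data \<Rightarrow> ('so \<Rightarrow> 'cm) \<Rightarrow>
     ('co, 'cm, 'do, 'dm) fun_data \<Rightarrow> bool" where
  "preserves_lan S B D H J K \<eta> G \<longleftrightarrow> is_lan S B D H (G \<circ>\<^sub>F J) (G \<circ>\<^sub>F K) (whisker_l S G \<eta>)"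

definition reflects_ran ::
  "('so, 'sm) cat \<Rightarrow> ('bo, 'bm) cat \<Rightarrow> ('co, 'cm) cat \<Rightarrow> ('do, 'dm) cat \<Rightarrow>
     ('so, 'sm, 'bo, 'bm) fun_data \<Rightarrow> ('so, 'sm, 'co, 'cm) fun_data \<Rightarrow>
     ('co, 'cm, 'do, 'dm) fun_data \<Rightarrow> bool" where
  "reflects_ran S B C D H J G \<longleftrightarrow>
     (\<forall>K \<gamma>. is_functor B C K \<longrightarrow> nat_trans S C (K \<circ>\<^sub>F H) J \<gamma> \<longrightarrow>
        is_ran S B D H (G \<circ>\<^sub>F J) (G \<circ>\<^sub>F K) (whisker_l S G \<gamma>) \<longrightarrow> is_ran S B C H J K \<gamma>)"

definition reflects_lan ::
  "('so, 'sm) cat \<Rightarrow> ('bo, 'bm) cat \<Rightarrow> ('co, 'cm) cat \<Rightarrow> ('do, 'dm) cat \<Rightarrow>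
     ('so, 'sm, 'bo, 'bm) fun_data \<Rightarrow> ('so, 'sm, 'co, 'cm) fun_data \<Rightarrow>
     ('co, 'cm, 'do, 'dm) fun_data \<Rightarrow> bool" where
  "reflects_lan S B C D H J G \<longleftrightarrow>
     (\<forall>K \<eta>. is_functor B C K \<longrightarrow> nat_trans S C J (K \<circ>\<^sub>F H) \<eta> \<longrightarrow>
        is_lan S B D H (G \<circ>\<^sub>F J) (G \<circ>\<^sub>F K) (whisker_l S G \<eta>) \<longrightarrow> is_lan S B C H J K \<eta>)"

text \<open>Creation of the Kan extension of \<open>G J\<close> along \<open>H\<close>, to be used when the latter exists.\<close>

definition creates_ran ::
  "('so, 'sm) cat \<Rightarrow> ('bo, 'bm) cat \<Rightarrow> ('co, 'cm) cat \<Rightarrow> ('do, 'dm) cat \<Rightarrow>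
     ('so, 'sm, 'bo, 'bm) fun_data \<Rightarrow> ('so, 'sm, 'co, 'cm) fun_data \<Rightarrow>
     ('co, 'cm, 'do, 'dm) fun_data \<Rightarrow> bool" where
  "creates_ran S B C D H J G \<longleftrightarrow>
     reflects_ran S B C D H J G \<and>
     (\<exists>K \<gamma>. is_ran S B C H J K \<gamma> \<and> preserves_ran S B D H J K \<gamma> G)"

definition creates_lan ::
  "('so, 'sm) cat \<Rightarrow> ('bo, 'bm) cat \<Rightarrow> ('co, 'cm) cat \<Rightarrow> ('do, 'dm) cat \<Rightarrow>
     ('so, 'sm, 'bo, 'bm) fun_data \<Rightarrow> ('so, 'sm, 'co, 'cm) fun_data \<Rightarrow>
     ('co, 'cm, 'do, 'dm) fun_data \<Rightarrow> bool" where
  "creates_lan S B C D H J G \<longleftrightarrow>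
     reflects_lan S B C D H J G \<and>
     (\<exists>K \<eta>. is_lan S B C H J K \<eta> \<and> preserves_lan S B D H J K \<eta> G)"

text \<open>Absoluteness quantifies over all functors out of \<open>C\<close> into categories of the same Cat as \<open>C\<close>,
  i.e. with objects and arrows from the same types. In the creation predicates below, absoluteness
  is only ever a hypothesis, so testing it against these targets alone makes them stronger, not
  weaker.\<close>

definition absolute_ran ::
  "('so, 'sm) cat \<Rightarrow> ('bo, 'bm) cat \<Rightarrow> ('o, 'm) cat \<Rightarrow> ('so, 'sm, 'bo, 'bm) fun_data \<Rightarrow>
     ('so, 'sm, 'o, 'm) fun_data \<Rightarrow> ('bo, 'bm, 'o, 'm) fun_data \<Rightarrow> ('so \<Rightarrow> 'm) \<Rightarrow> bool" where
  "absolute_ran S B C H J K \<gamma> \<longleftrightarrow>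
     is_ran S B C H J K \<gamma> \<and>
     (\<forall>(D :: ('o, 'm) cat) G. is_functor C D G \<longrightarrow> preserves_ran S B D H J K \<gamma> G)"

definition absolute_lan ::
  "('so, 'sm) cat \<Rightarrow> ('bo, 'bm) cat \<Rightarrow> ('o, 'm) cat \<Rightarrow> ('so, 'sm, 'bo, 'bm) fun_data \<Rightarrow>
     ('so, 'sm, 'o, 'm) fun_data \<Rightarrow> ('bo, 'bm, 'o, 'm) fun_data \<Rightarrow> ('so \<Rightarrow> 'm) \<Rightarrow> bool" where
  "absolute_lan S B C H J K \<eta> \<longleftrightarrow>
     is_lan S B C H J K \<eta> \<and>
     (\<forall>(D :: ('o, 'm) cat) G. is_functor C D G \<longrightarrow> preserves_lan S B D H J K \<eta> G)"

text \<open>The type arguments of the following predicates are the types of objects and arrows of the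
  categories \<open>S\<close> and \<open>B\<close> (of the diagram category \<open>S\<close>, for limits), which HOL cannot quantify over
  inside a formula; a theorem leaving them as type variables covers all categories \<open>S\<close> and \<open>B\<close>.\<close>

definition creates_absolute_kan_extensions ::
  "('so \<times> 'sm \<times> 'bo \<times> 'bm) itself \<Rightarrow> ('co, 'cm) cat \<Rightarrow> ('do, 'dm) cat \<Rightarrow>
     ('co, 'cm, 'do, 'dm) fun_data \<Rightarrow> bool" where
  "creates_absolute_kan_extensions T C D G \<longleftrightarrow>
     (\<forall>(S :: ('so, 'sm) cat) (B :: ('bo, 'bm) cat) H J. is_functor S B H \<longrightarrow> is_functor S C J \<longrightarrow>
        ((\<exists>K \<gamma>. absolute_ran S B D H (G \<circ>\<^sub>F J) K \<gamma>) \<longrightarrow> creates_ran S B C D H J G) \<and>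
        ((\<exists>K \<eta>. absolute_lan S B D H (G \<circ>\<^sub>F J) K \<eta>) \<longrightarrow> creates_lan S B C D H J G))"

definition creates_absolute_limits ::
  "('so \<times> 'sm) itself \<Rightarrow> ('co, 'cm) cat \<Rightarrow> ('do, 'dm) cat \<Rightarrow>
     ('co, 'cm, 'do, 'dm) fun_data \<Rightarrow> bool" where
  "creates_absolute_limits T C D G \<longleftrightarrow>
     (\<forall>(S :: ('so, 'sm) cat) J. is_functor S C J \<longrightarrow>
        (\<exists>K \<gamma>. absolute_ran S terminal_cat D to_terminal (G \<circ>\<^sub>F J) K \<gamma>) \<longrightarrow>
        creates_ran S terminal_cat C D to_terminal J G)"

definition creates_absolute_colimits ::
  "('so \<times> 'sm) itself \<Rightarrow> ('co, 'cm) cat \<Rightarrow> ('do, 'dm) cat \<Rightarrow>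
     ('co, 'cm, 'do, 'dm) fun_data \<Rightarrow> bool" where
  "creates_absolute_colimits T C D G \<longleftrightarrow>
     (\<forall>(S :: ('so, 'sm) cat) J. is_functor S C J \<longrightarrow>
        (\<exists>K \<eta>. absolute_lan S terminal_cat D to_terminal (G \<circ>\<^sub>F J) K \<eta>) \<longrightarrow>
        creates_lan S terminal_cat C D to_terminal J G)"

end

theory Submission
  imports Defs
begin

text \<open>
  The lax descent category is built from \<open>\<A>(1)\<close> in two steps. A morphism
  \<open>\<phi> : \<A>(d\<^sup>1) w \<rightarrow> \<A>(d\<^sup>0) w\<close> is an object of the inserter of \<open>F = \<A>(d\<^sup>1)\<close> and \<open>G = \<A>(d\<^sup>0)\<close>, and each
  of the two descent axioms equates two natural transformations \<open>P \<Rightarrow> Q\<close> built from \<open>\<phi>\<close>, with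
  \<open>P\<close> and \<open>Q\<close> functors on \<open>\<A>(1)\<close>: the cocycle axiom has \<open>Q = \<A>(D\<^sup>0) \<A>(d\<^sup>0)\<close>, the unit axiom has
  \<open>Q = id\<close>. Only this shape matters for creation, so the argument is carried out in the locale
  \<open>equifier_of_inserter\<close>, for a forgetful functor \<open>U : E \<rightarrow> C\<close>.

  Suppose that \<open>(L, \<delta>)\<close> is an absolute right Kan extension of \<open>U J\<close> along \<open>H\<close>. Since \<open>G\<close> preserves
  it, the transformation \<open>\<phi>\<^sub>J \<cdot> F \<delta> : F L H \<Rightarrow> G U J\<close> factors through \<open>G \<delta>\<close> as \<open>G \<delta> \<cdot> \<psi> H\<close> for a unique
  \<open>\<psi> : F L \<Rightarrow> G L\<close>. Since every \<open>Q\<close> preserves it too, the equations between transformations into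
  \<open>Q L\<close> can be tested after composing with \<open>Q \<delta>\<close>, where they reduce to the equations for \<open>J\<close>. So
  \<open>(L, \<psi>)\<close> is a functor \<open>K\<close> into \<open>E\<close>, and \<open>\<delta>\<close> lifts to it by the very choice of \<open>\<psi>\<close>
  (\<open>creates_absolute_ran\<close>). Its universal property is an instance of reflection: a transformation
  \<open>U R \<Rightarrow> U K\<close> obtained from the universal property in \<open>C\<close> is compatible with the structures because
  this, again, can be tested after composing with \<open>G \<delta>\<close> (\<open>is_ran_reflect\<close>).

  Left Kan extensions need no second argument: reversing all arrows exchanges \<open>F\<close> with \<open>G\<close> and
  \<open>P\<close> with \<open>Q\<close>, so that the hypotheses of the locale are self-dual (\<open>opposite\<close>). The cells
  of the pseudofunctor enter through their naturality and invertibility, which make the two sides of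
  each descent axiom natural in \<open>(w, \<phi>)\<close> (\<open>lax_desc_equifier\<close>).
\<close>

section \<open>Natural transformations and opposite categories\<close>

lemma op_cat_simps [simp]:
  "Obj (op_cat C) = Obj C" "Arr (op_cat C) = Arr C" "Dom (op_cat C) = Cod C" "Cod (op_cat C) = Dom C"
  "Id (op_cat C) = Id C" "Comp (op_cat C) g f = Comp C f g" "hom (op_cat C) x y = hom C y x"
  by (auto simp: op_cat_def hom_def)

lemma comp_fun_simps [simp]:
  "fobj (G \<circ>\<^sub>F F) x = fobj G (fobj F x)" "farr (G \<circ>\<^sub>F F) f = farr G (farr F f)"
  by (simp_all add: comp_fun_def)

lemma comp_fun_assoc: "(G \<circ>\<^sub>F F) \<circ>\<^sub>F H = G \<circ>\<^sub>F F \<circ>\<^sub>F H"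
  by (simp add: comp_fun_def comp_assoc)

lemma is_functor_comp_fun:
  assumes "is_functor A B F" "is_functor B C G"
  shows "is_functor A C (G \<circ>\<^sub>F F)"
proof -
  interpret F: is_functor A B F by fact
  interpret G: is_functor B C G by fact
  show ?thesis
    by unfold_locales
      (auto intro: F.F_Obj F.F_hom G.F_Obj G.F_hom simp: F.F_Id G.F_Id[OF F.F_Obj] F.F_Comp G.F_Comp[OF F.F_hom F.F_hom])
qed

lemma is_functor_id_fun: "category C \<Longrightarrow> is_functor C C id_fun"
  by (simp add: is_functor_def is_functor_axioms_def id_fun_def)

lemma is_functor_op_iff: "is_functor (op_cat B) (op_cat C) F \<longleftrightarrow> is_functor B C F"
  using is_functor_op_fun[of B C F] is_functor_op_fun[of "op_cat B" "op_cat C" F]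
  by (auto simp: op_fun_def op_cat_op_cat)

lemma nat_transI:
  assumes "\<And>x. x \<in> Obj B \<Longrightarrow> \<alpha> x \<in> hom C (fobj F x) (fobj G x)"
    and "\<And>x y f. f \<in> hom B x y \<Longrightarrow> Comp C (\<alpha> y) (farr F f) = Comp C (farr G f) (\<alpha> x)"
    and "category B"
  shows "nat_trans B C F G (restrict \<alpha> (Obj B))"
proof -
  interpret category B by fact
  have "x \<in> Obj B" "y \<in> Obj B" if "f \<in> hom B x y" for f x y
    using that Dom_Obj[of f] Cod_Obj[of f] by (auto simp: hom_def)
  then show ?thesis using assms by (auto simp: nat_trans_def)
qed

lemma nat_trans_hom: "nat_trans B C F G \<alpha> \<Longrightarrow> x \<in> Obj B \<Longrightarrow> \<alpha> x \<in> hom C (fobj F x) (fobj G x)"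
  by (simp add: nat_trans_def)

lemma nat_trans_square:
  "nat_trans B C F G \<alpha> \<Longrightarrow> f \<in> hom B x y \<Longrightarrow> Comp C (\<alpha> y) (farr F f) = Comp C (farr G f) (\<alpha> x)"
  by (simp add: nat_trans_def)

lemma nat_trans_eqI:
  "nat_trans B C F G \<alpha> \<Longrightarrow> nat_trans B C F' G' \<beta> \<Longrightarrow> (\<And>x. x \<in> Obj B \<Longrightarrow> \<alpha> x = \<beta> x) \<Longrightarrow> \<alpha> = \<beta>"
  unfolding nat_trans_def by (blast intro: extensionalityI)

lemma nat_trans_op_iff: "nat_trans (op_cat B) (op_cat C) F G \<alpha> \<longleftrightarrow> nat_trans B C G F \<alpha>"
  by (auto simp: nat_trans_def)

context category
begin

lemma hom_Obj: "f \<in> hom C x y \<Longrightarrow> x \<in> Obj C" "f \<in> hom C x y \<Longrightarrow> y \<in> Obj C"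
  using Dom_Obj Cod_Obj by (auto simp: hom_def)

lemma paste_squares:
  assumes "f \<in> hom C x y" "g \<in> hom C y z" "f' \<in> hom C x' y'" "g' \<in> hom C y' z'"
    and "u \<in> hom C x x'" "v \<in> hom C y y'" "w \<in> hom C z z'"
    and "Comp C v f = Comp C f' u" "Comp C w g = Comp C g' v"
  shows "Comp C w (Comp C g f) = Comp C (Comp C g' f') u"
proof -
  have "Comp C w (Comp C g f) = Comp C (Comp C g' v) f"
    using Comp_assoc[OF assms(1,2,7)] assms(9) by simp
  also have "\<dots> = Comp C g' (Comp C f' u)"
    using Comp_assoc[OF assms(1,6,4)] assms(8) by simp
  finally show ?thesis using Comp_assoc[OF assms(5,3,4)] by simp
qed

lemma inv_arr:
  assumes "is_iso C f" "f \<in> hom C x y"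
  shows "inv_arr C f \<in> hom C y x" "Comp C (inv_arr C f) f = Id C x" "Comp C f (inv_arr C f) = Id C y"
proof -
  obtain g where g: "inverse_arrows C f g" using assms(1) by (auto simp: is_iso_def)
  have "g' = g" if "inverse_arrows C f g'" for g'
  proof -
    have h: "g \<in> hom C y x" "g' \<in> hom C y x" using g that assms(2) by (auto simp: inverse_arrows_def hom_def)
    have "g' = Comp C g' (Comp C f g)" using g h assms(2) Comp_Id[of g' y x] by (auto simp: inverse_arrows_def hom_def)
    also have "\<dots> = Comp C (Comp C g' f) g" by (rule Comp_assoc[OF h(1) assms(2) h(2)])
    also have "\<dots> = g" using that h assms(2) Id_Comp[of g y x] by (auto simp: inverse_arrows_def hom_def)
    finally show ?thesis .
  qed
  with g have "inv_arr C f = g" unfolding inv_arr_def by blast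
  with g assms(2) show "inv_arr C f \<in> hom C y x" "Comp C (inv_arr C f) f = Id C x" "Comp C f (inv_arr C f) = Id C y"
    by (auto simp: inverse_arrows_def hom_def)
qed

lemma inv_square:
  assumes a: "is_iso C a" "a \<in> hom C x y" and b: "is_iso C b" "b \<in> hom C x' y'"
    and u: "u \<in> hom C x x'" and v: "v \<in> hom C y y'" and sq: "Comp C b u = Comp C v a"
  shows "Comp C (inv_arr C b) v = Comp C u (inv_arr C a)"
proof -
  let ?a = "inv_arr C a" and ?b = "inv_arr C b"
  note ia = inv_arr[OF a] and ib = inv_arr[OF b]
  have "Comp C ?b v = Comp C ?b (Comp C v (Comp C a ?a))" using Comp_Id[OF v] ia by simp
  also have "\<dots> = Comp C ?b (Comp C (Comp C b u) ?a)" by (simp add: sq Comp_assoc[OF ia(1) a(2) v])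
  also have "\<dots> = Comp C (Comp C ?b (Comp C b u)) ?a"
    by (rule Comp_assoc[OF ia(1) Comp_hom[OF u b(2)] ib(1)])
  also have "\<dots> = Comp C u ?a" by (simp add: Comp_assoc[OF u b(2) ib(1)] ib Id_Comp[OF u])
  finally show ?thesis .
qed

end

lemma nat_trans_vcomp:
  assumes "is_functor B C F" "is_functor B C G" "is_functor B C K"
    and \<alpha>: "nat_trans B C F G \<alpha>" and \<beta>: "nat_trans B C G K \<beta>"
  shows "nat_trans B C F K (vcomp B C \<beta> \<alpha>)"
proof -
  interpret F: is_functor B C F by fact
  interpret G: is_functor B C G by fact
  interpret K: is_functor B C K by fact
  show ?thesis unfolding vcomp_def
  proof (rule nat_transI)
    show "Comp C (\<beta> x) (\<alpha> x) \<in> hom C (fobj F x) (fobj K x)" if "x \<in> Obj B" for x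
      by (rule F.C.Comp_hom[OF nat_trans_hom[OF \<alpha> that] nat_trans_hom[OF \<beta> that]])
    show "Comp C (Comp C (\<beta> y) (\<alpha> y)) (farr F f) = Comp C (farr K f) (Comp C (\<beta> x) (\<alpha> x))"
      if f: "f \<in> hom B x y" for f x y
    proof -
      note x = F.B.hom_Obj(1)[OF f] and y = F.B.hom_Obj(2)[OF f]
      show ?thesis
        by (rule F.C.paste_squares[OF nat_trans_hom[OF \<alpha> x] nat_trans_hom[OF \<beta> x]
              nat_trans_hom[OF \<alpha> y] nat_trans_hom[OF \<beta> y] F.F_hom[OF f] G.F_hom[OF f] K.F_hom[OF f]
              nat_trans_square[OF \<alpha> f, symmetric] nat_trans_square[OF \<beta> f, symmetric], symmetric])
    qed
  qed (rule F.B.category_axioms)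
qed

lemma nat_trans_whisker_r:
  assumes "is_functor S B H" and \<beta>: "nat_trans B C R K \<beta>"
  shows "nat_trans S C (R \<circ>\<^sub>F H) (K \<circ>\<^sub>F H) (whisker_r S \<beta> H)"
proof -
  interpret H: is_functor S B H by fact
  show ?thesis unfolding whisker_r_def
    by (rule nat_transI)
      (simp_all add: nat_trans_hom[OF \<beta> H.F_Obj] nat_trans_square[OF \<beta> H.F_hom] H.B.category_axioms)
qed

lemma nat_trans_whisker_l:
  assumes "is_functor B C F" "is_functor B C F'" "is_functor C D G" and \<gamma>: "nat_trans B C F F' \<gamma>"
  shows "nat_trans B D (G \<circ>\<^sub>F F) (G \<circ>\<^sub>F F') (whisker_l B G \<gamma>)"
proof -
  interpret F: is_functor B C F by fact
  interpret F': is_functor B C F' by fact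
  interpret G: is_functor C D G by fact
  show ?thesis unfolding whisker_l_def
  proof (rule nat_transI)
    fix x y f assume f: "f \<in> hom B x y"
    note x = F.B.hom_Obj(1)[OF f] and y = F.B.hom_Obj(2)[OF f]
    show "Comp D (farr G (\<gamma> y)) (farr (G \<circ>\<^sub>F F) f) = Comp D (farr (G \<circ>\<^sub>F F') f) (farr G (\<gamma> x))"
      using G.F_Comp[OF F.F_hom[OF f] nat_trans_hom[OF \<gamma> y]]
        G.F_Comp[OF nat_trans_hom[OF \<gamma> x] F'.F_hom[OF f]] nat_trans_square[OF \<gamma> f] by simp
  qed (simp_all add: G.F_hom nat_trans_hom[OF \<gamma>] F.B.category_axioms)
qed

lemma vcomp_apply: "x \<in> Obj B \<Longrightarrow> vcomp B C \<beta> \<alpha> x = Comp C (\<beta> x) (\<alpha> x)"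
  by (simp add: vcomp_def)

lemma whisker_l_apply: "s \<in> Obj S \<Longrightarrow> whisker_l S G \<gamma> s = farr G (\<gamma> s)"
  by (simp add: whisker_l_def)

section \<open>Kan extensions\<close>

text \<open>The bijections in \<^const>\<open>is_ran\<close> are unfolded to unique factorisation, stated componentwise, so
  that whiskerings disappear from the arguments below.\<close>

lemma bij_betw_iff_ex1:
  "bij_betw f A B \<longleftrightarrow> (\<forall>x\<in>A. f x \<in> B) \<and> (\<forall>y\<in>B. \<exists>!x. x \<in> A \<and> f x = y)"
  unfolding bij_betw_def inj_on_def by blast

lemma is_ran_iff:
  assumes H: "is_functor S B H" and J: "is_functor S C J"
  shows "is_ran S B C H J K \<gamma> \<longleftrightarrow>
    is_functor B C K \<and> nat_trans S C (K \<circ>\<^sub>F H) J \<gamma> \<and>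
    (\<forall>R \<tau>. is_functor B C R \<longrightarrow> nat_trans S C (R \<circ>\<^sub>F H) J \<tau> \<longrightarrow>
       (\<exists>!\<beta>. nat_trans B C R K \<beta> \<and> (\<forall>s\<in>Obj S. Comp C (\<gamma> s) (\<beta> (fobj H s)) = \<tau> s)))"
proof -
  let ?t = "\<lambda>\<beta>. vcomp S C \<gamma> (whisker_r S \<beta> H)"
  have *: "bij_betw ?t {\<beta>. nat_trans B C R K \<beta>} {\<tau>. nat_trans S C (R \<circ>\<^sub>F H) J \<tau>} \<longleftrightarrow>
      (\<forall>\<tau>. nat_trans S C (R \<circ>\<^sub>F H) J \<tau> \<longrightarrow>
        (\<exists>!\<beta>. nat_trans B C R K \<beta> \<and> (\<forall>s\<in>Obj S. Comp C (\<gamma> s) (\<beta> (fobj H s)) = \<tau> s)))"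
    if K: "is_functor B C K" and \<gamma>: "nat_trans S C (K \<circ>\<^sub>F H) J \<gamma>" and R: "is_functor B C R" for R
  proof -
    have "nat_trans S C (R \<circ>\<^sub>F H) J (?t \<beta>)" if "nat_trans B C R K \<beta>" for \<beta>
      by (rule nat_trans_vcomp[OF is_functor_comp_fun[OF H R] is_functor_comp_fun[OF H K] J
            nat_trans_whisker_r[OF H that] \<gamma>])
    moreover have "?t \<beta> = \<tau> \<longleftrightarrow> (\<forall>s\<in>Obj S. Comp C (\<gamma> s) (\<beta> (fobj H s)) = \<tau> s)"
      if "nat_trans S C (R \<circ>\<^sub>F H) J \<tau>" for \<beta> \<tau>
      using that unfolding nat_trans_def vcomp_def whisker_r_def
      by (auto simp: extensional_def fun_eq_iff)
    ultimately show ?thesis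
      unfolding bij_betw_iff_ex1 by simp
  qed
  show ?thesis
    unfolding is_ran_def
  proof (intro conj_cong refl iffI allI impI)
    fix R \<tau> assume "is_functor B C K" "nat_trans S C (K \<circ>\<^sub>F H) J \<gamma>" "is_functor B C R"
      "nat_trans S C (R \<circ>\<^sub>F H) J \<tau>"
      and "\<forall>R. is_functor B C R \<longrightarrow>
        bij_betw ?t {\<beta>. nat_trans B C R K \<beta>} {\<tau>. nat_trans S C (R \<circ>\<^sub>F H) J \<tau>}"
    then show "\<exists>!\<beta>. nat_trans B C R K \<beta> \<and> (\<forall>s\<in>Obj S. Comp C (\<gamma> s) (\<beta> (fobj H s)) = \<tau> s)"
      using *[of R] by blast
  next
    fix R assume "is_functor B C K" "nat_trans S C (K \<circ>\<^sub>F H) J \<gamma>" "is_functor B C R"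
      and "\<forall>R \<tau>. is_functor B C R \<longrightarrow> nat_trans S C (R \<circ>\<^sub>F H) J \<tau> \<longrightarrow>
       (\<exists>!\<beta>. nat_trans B C R K \<beta> \<and> (\<forall>s\<in>Obj S. Comp C (\<gamma> s) (\<beta> (fobj H s)) = \<tau> s))"
    then show "bij_betw ?t {\<beta>. nat_trans B C R K \<beta>} {\<tau>. nat_trans S C (R \<circ>\<^sub>F H) J \<tau>}"
      using *[of R] by simp
  qed
qed

context
  fixes S B C H J K \<gamma>
  assumes H: "is_functor S B H" and J: "is_functor S C J" and ran: "is_ran S B C H J K \<gamma>"
begin

lemma ran_functor: "is_functor B C K"
  and ran_counit: "nat_trans S C (K \<circ>\<^sub>F H) J \<gamma>"
  using ran unfolding is_ran_iff[OF H J] by blast+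

lemma ran_factor:
  assumes "is_functor B C R" "nat_trans S C (R \<circ>\<^sub>F H) J \<tau>"
  shows "\<exists>\<beta>. nat_trans B C R K \<beta> \<and> (\<forall>s\<in>Obj S. Comp C (\<gamma> s) (\<beta> (fobj H s)) = \<tau> s)"
  using ran assms unfolding is_ran_iff[OF H J] by blast

lemma ran_eqI:
  assumes "is_functor B C R" "nat_trans B C R K \<beta>" "nat_trans B C R K \<beta>'"
    and "\<And>s. s \<in> Obj S \<Longrightarrow> Comp C (\<gamma> s) (\<beta> (fobj H s)) = Comp C (\<gamma> s) (\<beta>' (fobj H s))"
  shows "\<beta> = \<beta>'"
proof -
  let ?t = "\<lambda>\<beta>. vcomp S C \<gamma> (whisker_r S \<beta> H)"
  have "inj_on ?t {\<beta>. nat_trans B C R K \<beta>}"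
    using ran assms(1) by (simp add: is_ran_def bij_betw_def)
  moreover have "?t \<beta> = ?t \<beta>'"
    using assms(4) by (simp add: vcomp_def whisker_r_def cong: restrict_cong)
  ultimately show ?thesis using assms(2,3) by (simp add: inj_on_def)
qed

end


text \<open>The pair \<open>\<theta>\<close>, \<open>\<theta>'\<close> is an isomorphism \<open>K' \<cong> K\<close>: the factorisation through \<open>\<gamma>'\<close> is \<open>\<theta>'\<close> after the one
  through \<open>\<gamma>\<close>, and it is unique because \<open>\<theta>\<close> after it factors through \<open>\<gamma>\<close>.\<close>

lemma is_ran_transport:
  assumes H: "is_functor S B H" and J: "is_functor S C J" and ran: "is_ran S B C H J K \<gamma>"
    and K': "is_functor B C K'" and \<gamma>': "nat_trans S C (K' \<circ>\<^sub>F H) J \<gamma>'"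
    and \<theta>: "nat_trans B C K' K \<theta>" and \<theta>': "nat_trans B C K K' \<theta>'"
    and inv1: "\<And>b. b \<in> Obj B \<Longrightarrow> Comp C (\<theta> b) (\<theta>' b) = Id C (fobj K b)"
    and inv2: "\<And>b. b \<in> Obj B \<Longrightarrow> Comp C (\<theta>' b) (\<theta> b) = Id C (fobj K' b)"
    and eq: "\<And>s. s \<in> Obj S \<Longrightarrow> Comp C (\<gamma> s) (\<theta> (fobj H s)) = \<gamma>' s"
  shows "is_ran S B C H J K' \<gamma>'"
  unfolding is_ran_iff[OF H J]
proof (intro conjI allI impI K' \<gamma>')
  interpret H: is_functor S B H by fact
  interpret K': is_functor B C K' by fact
  note K = ran_functor[OF H J ran] and \<gamma> = ran_counit[OF H J ran]
  fix R \<tau> assume R: "is_functor B C R" and \<tau>: "nat_trans S C (R \<circ>\<^sub>F H) J \<tau>"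
  obtain \<beta> where \<beta>: "nat_trans B C R K \<beta>" and \<beta>\<tau>: "\<And>s. s \<in> Obj S \<Longrightarrow> Comp C (\<gamma> s) (\<beta> (fobj H s)) = \<tau> s"
    using ran_factor[OF H J ran R \<tau>] by blast
  have n: "nat_trans B C R K' (vcomp B C \<theta>' \<beta>)"
    by (rule nat_trans_vcomp[OF R K K' \<beta> \<theta>'])
  show "\<exists>!\<beta>. nat_trans B C R K' \<beta> \<and> (\<forall>s\<in>Obj S. Comp C (\<gamma>' s) (\<beta> (fobj H s)) = \<tau> s)"
  proof (rule ex1I[of _ "vcomp B C \<theta>' \<beta>"])
    have "Comp C (\<gamma>' s) (Comp C (\<theta>' (fobj H s)) (\<beta> (fobj H s))) = \<tau> s" if s: "s \<in> Obj S" for s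
    proof -
      note b = H.F_Obj[OF s]
      note h = nat_trans_hom[OF \<theta> b] nat_trans_hom[OF \<theta>' b] nat_trans_hom[OF \<beta> b]
        nat_trans_hom[OF \<gamma> s, simplified]
      have "Comp C (\<gamma>' s) (Comp C (\<theta>' (fobj H s)) (\<beta> (fobj H s))) =
          Comp C (\<gamma> s) (Comp C (\<theta> (fobj H s)) (Comp C (\<theta>' (fobj H s)) (\<beta> (fobj H s))))"
        by (simp add: eq[OF s, symmetric] K'.C.Comp_assoc[OF K'.C.Comp_hom[OF h(3,2)] h(1,4)])
      also have "Comp C (\<theta> (fobj H s)) (Comp C (\<theta>' (fobj H s)) (\<beta> (fobj H s))) = \<beta> (fobj H s)"
        by (simp add: K'.C.Comp_assoc[OF h(3,2,1)] inv1[OF b] K'.C.Id_Comp[OF h(3)])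
      finally show ?thesis using \<beta>\<tau>[OF s] by simp
    qed
    with n show "nat_trans B C R K' (vcomp B C \<theta>' \<beta>) \<and>
        (\<forall>s\<in>Obj S. Comp C (\<gamma>' s) (vcomp B C \<theta>' \<beta> (fobj H s)) = \<tau> s)"
      by (simp add: vcomp_apply H.F_Obj)
  next
    fix \<delta> assume "nat_trans B C R K' \<delta> \<and> (\<forall>s\<in>Obj S. Comp C (\<gamma>' s) (\<delta> (fobj H s)) = \<tau> s)"
    then have \<delta>: "nat_trans B C R K' \<delta>"
      and \<delta>\<tau>: "\<And>s. s \<in> Obj S \<Longrightarrow> Comp C (\<gamma>' s) (\<delta> (fobj H s)) = \<tau> s" by auto
    have "vcomp B C \<theta> \<delta> = \<beta>"
    proof (rule ran_eqI[OF H J ran R nat_trans_vcomp[OF R K' K \<delta> \<theta>] \<beta>])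
      fix s assume s: "s \<in> Obj S"
      note b = H.F_Obj[OF s]
      show "Comp C (\<gamma> s) (vcomp B C \<theta> \<delta> (fobj H s)) = Comp C (\<gamma> s) (\<beta> (fobj H s))"
        using K'.C.Comp_assoc[OF nat_trans_hom[OF \<delta> b] nat_trans_hom[OF \<theta> b] nat_trans_hom[OF \<gamma> s, simplified]]
        by (simp add: vcomp_apply[OF b] eq[OF s] \<delta>\<tau>[OF s] \<beta>\<tau>[OF s])
    qed
    then have \<beta>: "Comp C (\<theta> b) (\<delta> b) = \<beta> b" if "b \<in> Obj B" for b
      using that by (metis vcomp_apply)
    show "\<delta> = vcomp B C \<theta>' \<beta>"
    proof (rule nat_trans_eqI[OF \<delta> n])
      fix b assume b: "b \<in> Obj B"
      show "\<delta> b = vcomp B C \<theta>' \<beta> b"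
        using K'.C.Comp_assoc[OF nat_trans_hom[OF \<delta> b] nat_trans_hom[OF \<theta> b] nat_trans_hom[OF \<theta>' b]]
        by (simp add: vcomp_apply[OF b] \<beta>[OF b] inv2[OF b] K'.C.Id_Comp[OF nat_trans_hom[OF \<delta> b]])
    qed
  qed
qed

text \<open>Functors are data with irrelevant values off the carriers, so a lift \<open>K\<close> of \<open>L\<close> along \<open>U\<close>
  satisfies \<open>U K = L\<close> only on the carriers; the identities form the isomorphism along which the Kan
  extension is then transported.\<close>

lemma is_ran_cong_functor:
  assumes H: "is_functor S B H" and J: "is_functor S C J" and ran: "is_ran S B C H J K \<gamma>"
    and K': "is_functor B C K'"
    and obj: "\<And>b. b \<in> Obj B \<Longrightarrow> fobj K' b = fobj K b"
    and arr: "\<And>f x y. f \<in> hom B x y \<Longrightarrow> farr K' f = farr K f"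
  shows "is_ran S B C H J K' \<gamma>"
proof -
  interpret H: is_functor S B H by fact
  interpret K': is_functor B C K' by fact
  note \<gamma> = ran_counit[OF H J ran]
  let ?id = "\<lambda>b\<in>Obj B. Id C (fobj K' b)"
  have c: "Comp C (Id C (fobj K' y)) (farr K' f) = Comp C (farr K' f) (Id C (fobj K' x))"
    if "f \<in> hom B x y" for f x y
    using K'.F_hom[OF that] by (simp add: K'.C.Id_Comp K'.C.Comp_Id)
  have h: "Id C (fobj K' b) \<in> hom C (fobj K' b) (fobj K' b)" if "b \<in> Obj B" for b
    by (rule K'.C.Id_hom[OF K'.F_Obj[OF that]])
  have id: "nat_trans B C K' K ?id" "nat_trans B C K K' ?id"
    using c h by (auto intro!: nat_transI simp: H.C.category_axioms obj[symmetric] arr[symmetric])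
  have \<gamma>': "nat_trans S C (K' \<circ>\<^sub>F H) J \<gamma>"
    using \<gamma> by (simp add: nat_trans_def obj H.F_Obj arr[OF H.F_hom])
  show ?thesis
    by (rule is_ran_transport[OF H J ran K' \<gamma>' id])
      (simp_all add: obj[symmetric] H.F_Obj K'.C.Id_Comp[OF h] K'.C.Comp_Id[OF nat_trans_hom[OF \<gamma>', simplified]])
qed

text \<open>Both \<open>\<theta> \<theta>'\<close> and the identity are the unique factorisation of \<open>\<delta>\<close> through itself.\<close>

lemma ran_comparison_inverse:
  assumes H: "is_functor S B H" and J: "is_functor S C J" and ran: "is_ran S B C H J L \<delta>"
    and K: "is_functor B C K"
    and \<theta>: "nat_trans B C K L \<theta>" "\<And>s. s \<in> Obj S \<Longrightarrow> Comp C (\<delta> s) (\<theta> (fobj H s)) = \<gamma> s"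
    and \<theta>': "nat_trans B C L K \<theta>'" "\<And>s. s \<in> Obj S \<Longrightarrow> Comp C (\<gamma> s) (\<theta>' (fobj H s)) = \<delta> s"
    and b: "b \<in> Obj B"
  shows "Comp C (\<theta> b) (\<theta>' b) = Id C (fobj L b)"
proof -
  note L = ran_functor[OF H J ran] and \<delta> = ran_counit[OF H J ran]
  interpret H: is_functor S B H by fact
  interpret L: is_functor B C L by fact
  have id: "nat_trans B C L L (\<lambda>b\<in>Obj B. Id C (fobj L b))"
    by (rule nat_transI)
      (auto intro: L.C.Id_hom L.F_Obj simp: L.C.Id_Comp[OF L.F_hom] L.C.Comp_Id[OF L.F_hom] H.C.category_axioms)
  have "vcomp B C \<theta> \<theta>' = (\<lambda>b\<in>Obj B. Id C (fobj L b))"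
  proof (rule ran_eqI[OF H J ran L nat_trans_vcomp[OF L K L \<theta>'(1) \<theta>(1)] id])
    fix s assume s: "s \<in> Obj S"
    note b = H.F_Obj[OF s]
    show "Comp C (\<delta> s) (vcomp B C \<theta> \<theta>' (fobj H s)) =
        Comp C (\<delta> s) ((\<lambda>b\<in>Obj B. Id C (fobj L b)) (fobj H s))"
      using L.C.Comp_assoc[OF nat_trans_hom[OF \<theta>'(1) b] nat_trans_hom[OF \<theta>(1) b] nat_trans_hom[OF \<delta> s, simplified]]
      by (simp add: vcomp_apply b \<theta>(2)[OF s] \<theta>'(2)[OF s] L.C.Comp_Id[OF nat_trans_hom[OF \<delta> s, simplified]])
  qed
  from fun_cong[OF this, of b] b show ?thesis by (simp add: vcomp_apply)
qed

text \<open>Two right Kan extensions of the same functor are isomorphic, and functors preserve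
  isomorphisms, so that preservation does not depend on the choice of the Kan extension.\<close>

lemma absolute_ran_preserves_ran:
  fixes C D :: "('o, 'm) cat"
  assumes H: "is_functor S B H" and J: "is_functor S C J"
    and abs: "absolute_ran S B C H J L \<delta>" and ran': "is_ran S B C H J K \<gamma>"
    and G: "is_functor C D G"
  shows "preserves_ran S B D H J K \<gamma> G"
proof -
  interpret H: is_functor S B H by fact
  interpret G: is_functor C D G by fact
  have ran: "is_ran S B C H J L \<delta>" and ranG: "is_ran S B D H (G \<circ>\<^sub>F J) (G \<circ>\<^sub>F L) (whisker_l S G \<delta>)"
    using abs G by (auto simp: absolute_ran_def preserves_ran_def)
  note L = ran_functor[OF H J ran] and \<delta> = ran_counit[OF H J ran]
  note K = ran_functor[OF H J ran'] and \<gamma> = ran_counit[OF H J ran']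
  obtain \<theta> where \<theta>: "nat_trans B C K L \<theta>" "\<And>s. s \<in> Obj S \<Longrightarrow> Comp C (\<delta> s) (\<theta> (fobj H s)) = \<gamma> s"
    using ran_factor[OF H J ran K \<gamma>] by blast
  obtain \<theta>' where \<theta>': "nat_trans B C L K \<theta>'" "\<And>s. s \<in> Obj S \<Longrightarrow> Comp C (\<gamma> s) (\<theta>' (fobj H s)) = \<delta> s"
    using ran_factor[OF H J ran' L \<delta>] by blast
  interpret L: is_functor B C L by fact
  interpret K: is_functor B C K by fact
  have G_comp: "Comp D (farr G (\<beta> b)) (farr G (\<alpha> b)) = Id D (fobj G (fobj X b))"
    if "b \<in> Obj B" "nat_trans B C X Y \<alpha>" "nat_trans B C Y X \<beta>" "fobj X b \<in> Obj C"
      "Comp C (\<beta> b) (\<alpha> b) = Id C (fobj X b)" for X Y \<alpha> \<beta> b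
    using that G.F_Comp[OF nat_trans_hom[OF that(2,1)] nat_trans_hom[OF that(3,1)]] G.F_Id by simp
  show ?thesis unfolding preserves_ran_def
  proof (rule is_ran_transport[OF H is_functor_comp_fun[OF J G] ranG is_functor_comp_fun[OF K G]
        nat_trans_whisker_l[OF is_functor_comp_fun[OF H K] J G \<gamma>, folded comp_fun_assoc]
        nat_trans_whisker_l[OF K L G \<theta>(1)] nat_trans_whisker_l[OF L K G \<theta>'(1)]])
    fix b assume b: "b \<in> Obj B"
    show "Comp D (whisker_l B G \<theta> b) (whisker_l B G \<theta>' b) = Id D (fobj (G \<circ>\<^sub>F L) b)"
      using G_comp[OF b \<theta>'(1) \<theta>(1) L.F_Obj[OF b] ran_comparison_inverse[OF H J ran K \<theta> \<theta>' b]]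
      by (simp add: whisker_l_apply b)
    show "Comp D (whisker_l B G \<theta>' b) (whisker_l B G \<theta> b) = Id D (fobj (G \<circ>\<^sub>F K) b)"
      using G_comp[OF b \<theta>(1) \<theta>'(1) K.F_Obj[OF b] ran_comparison_inverse[OF H J ran' L \<theta>' \<theta> b]]
      by (simp add: whisker_l_apply b)
  next
    fix s assume s: "s \<in> Obj S"
    show "Comp D (whisker_l S G \<delta> s) (whisker_l B G \<theta> (fobj H s)) = whisker_l S G \<gamma> s"
      using G.F_Comp[OF nat_trans_hom[OF \<theta>(1) H.F_Obj[OF s]] nat_trans_hom[OF \<delta> s, simplified]] \<theta>(2)[OF s]
      by (simp add: whisker_l_apply s H.F_Obj)
  qed
qed

section \<open>Inserters with equations\<close>

text \<open>An object of the inserter of \<open>F\<close> and \<open>G\<close> is a pair \<open>(w, \<psi> : F w \<rightarrow> G w)\<close>, and an arrow is an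
  arrow \<open>m\<close> of \<open>C\<close> commuting with these. With \<open>V\<close> the projection \<open>(w, \<psi>) \<mapsto> w\<close> to \<open>C\<close>, the following
  are the natural transformations \<open>P V \<Rightarrow> Q V\<close>, described without forming the inserter.\<close>

definition inserter_transformation ::
  "('co, 'cm) cat \<Rightarrow> ('do, 'dm) cat \<Rightarrow> ('co, 'cm, 'do, 'dm) fun_data \<Rightarrow> ('co, 'cm, 'do, 'dm) fun_data \<Rightarrow>
    ('to, 'tm) cat \<Rightarrow> ('co, 'cm, 'to, 'tm) fun_data \<Rightarrow> ('co, 'cm, 'to, 'tm) fun_data \<Rightarrow>
    ('co \<Rightarrow> 'dm \<Rightarrow> 'tm) \<Rightarrow> bool" where
  "inserter_transformation C D F G T P Q l \<longleftrightarrow>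
    (\<forall>w\<in>Obj C. \<forall>\<psi>\<in>hom D (fobj F w) (fobj G w). l w \<psi> \<in> hom T (fobj P w) (fobj Q w)) \<and>
    (\<forall>w w'. \<forall>m\<in>hom C w w'. \<forall>\<psi>\<in>hom D (fobj F w) (fobj G w). \<forall>\<psi>'\<in>hom D (fobj F w') (fobj G w').
       Comp D (farr G m) \<psi> = Comp D \<psi>' (farr F m) \<longrightarrow>
       Comp T (farr Q m) (l w \<psi>) = Comp T (l w' \<psi>') (farr P m))"

lemma inserter_transformation_hom:
  "inserter_transformation C D F G T P Q l \<Longrightarrow> w \<in> Obj C \<Longrightarrow> \<psi> \<in> hom D (fobj F w) (fobj G w) \<Longrightarrow>
    l w \<psi> \<in> hom T (fobj P w) (fobj Q w)"
  by (simp add: inserter_transformation_def)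

lemma inserter_transformation_square:
  "inserter_transformation C D F G T P Q l \<Longrightarrow> m \<in> hom C w w' \<Longrightarrow>
    \<psi> \<in> hom D (fobj F w) (fobj G w) \<Longrightarrow> \<psi>' \<in> hom D (fobj F w') (fobj G w') \<Longrightarrow>
    Comp D (farr G m) \<psi> = Comp D \<psi>' (farr F m) \<Longrightarrow>
    Comp T (farr Q m) (l w \<psi>) = Comp T (l w' \<psi>') (farr P m)"
  by (simp add: inserter_transformation_def)

lemma inserter_transformation_op:
  assumes "inserter_transformation C D F G T P Q l"
  shows "inserter_transformation (op_cat C) (op_cat D) G F (op_cat T) Q P l"
  using assms unfolding inserter_transformation_def by simp

text \<open>The pair \<open>(L, \<psi>)\<close> is a functor from \<open>B\<close> to the inserter, along which \<open>l\<close> is whiskered.\<close>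

lemma inserter_transformation_along:
  assumes l: "inserter_transformation C D F G T P Q l" and L: "is_functor B C L"
    and \<psi>: "nat_trans B D (F \<circ>\<^sub>F L) (G \<circ>\<^sub>F L) \<psi>"
  shows "nat_trans B T (P \<circ>\<^sub>F L) (Q \<circ>\<^sub>F L) (\<lambda>b\<in>Obj B. l (fobj L b) (\<psi> b))"
proof -
  interpret L: is_functor B C L by fact
  note h = nat_trans_hom[OF \<psi>, simplified]
  show ?thesis
  proof (rule nat_transI)
    show "l (fobj L b) (\<psi> b) \<in> hom T (fobj (P \<circ>\<^sub>F L) b) (fobj (Q \<circ>\<^sub>F L) b)" if "b \<in> Obj B" for b
      using inserter_transformation_hom[OF l L.F_Obj[OF that] h[OF that]] by simp
    show "Comp T (l (fobj L c) (\<psi> c)) (farr (P \<circ>\<^sub>F L) f) = Comp T (farr (Q \<circ>\<^sub>F L) f) (l (fobj L b) (\<psi> b))"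
      if f: "f \<in> hom B b c" for f b c
      using inserter_transformation_square[OF l L.F_hom[OF f] h[OF L.B.hom_Obj(1)[OF f]] h[OF L.B.hom_Obj(2)[OF f]]]
        nat_trans_square[OF \<psi> f] by simp
  qed (rule L.B.category_axioms)
qed

text \<open>Here \<open>E\<close> is, up to equivalence over \<open>C\<close>, the full subcategory of the
  inserter of \<open>F\<close> and \<open>G\<close> on the pairs at which \<open>l i\<close> and \<open>r i\<close> agree for all \<open>i\<close>; \<open>\<phi> x\<close> is the
  structure carried by \<open>x\<close>. Describing \<open>E\<close> by lifting properties of \<open>U\<close> makes the hypotheses stable
  under reversal of arrows. The categories \<open>D\<close> and \<open>T i\<close> have objects and arrows of the same types
  as \<open>C\<close> since these are the targets against which \<^const>\<open>absolute_ran\<close> is tested.\<close>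

locale equifier_of_inserter =
  U: is_functor E C U + F: is_functor C D F + G: is_functor C D G
  for E :: "('eo, 'em) cat" and C D :: "('o, 'm) cat" and U F G +
  fixes \<phi> :: "'eo \<Rightarrow> 'm" and T :: "'i \<Rightarrow> ('o, 'm) cat" and P Q and l r :: "'i \<Rightarrow> 'o \<Rightarrow> 'm \<Rightarrow> 'm"
  assumes structure_hom: "x \<in> Obj E \<Longrightarrow> \<phi> x \<in> hom D (fobj F (fobj U x)) (fobj G (fobj U x))"
    and structure_square:
      "f \<in> hom E x y \<Longrightarrow> Comp D (farr G (farr U f)) (\<phi> x) = Comp D (\<phi> y) (farr F (farr U f))"
    and faithful: "f \<in> hom E x y \<Longrightarrow> g \<in> hom E x y \<Longrightarrow> farr U f = farr U g \<Longrightarrow> f = g"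
    and lift_arrow: "x \<in> Obj E \<Longrightarrow> y \<in> Obj E \<Longrightarrow> m \<in> hom C (fobj U x) (fobj U y) \<Longrightarrow>
      Comp D (farr G m) (\<phi> x) = Comp D (\<phi> y) (farr F m) \<Longrightarrow> \<exists>f\<in>hom E x y. farr U f = m"
    and functor_P: "is_functor C (T i) (P i)"
    and functor_Q: "is_functor C (T i) (Q i)"
    and transformation_l: "inserter_transformation C D F G (T i) (P i) (Q i) (l i)"
    and transformation_r: "inserter_transformation C D F G (T i) (P i) (Q i) (r i)"
    and structure_equation: "x \<in> Obj E \<Longrightarrow> l i (fobj U x) (\<phi> x) = r i (fobj U x) (\<phi> x)"
    and lift_object: "w \<in> Obj C \<Longrightarrow> \<psi> \<in> hom D (fobj F w) (fobj G w) \<Longrightarrow>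
      (\<And>i. l i w \<psi> = r i w \<psi>) \<Longrightarrow> \<exists>x\<in>Obj E. fobj U x = w \<and> \<phi> x = \<psi>"
begin

lemma opposite: "equifier_of_inserter (op_cat E) (op_cat C) (op_cat D) U G F \<phi> (\<lambda>i. op_cat (T i)) Q P l r"
  unfolding equifier_of_inserter_def equifier_of_inserter_axioms_def is_functor_op_iff
  using structure_hom structure_square faithful lift_arrow functor_P functor_Q structure_equation lift_object
    inserter_transformation_op[OF transformation_l] inserter_transformation_op[OF transformation_r]
    U.is_functor_axioms F.is_functor_axioms G.is_functor_axioms
  by (simp; blast)

text \<open>A functor into \<open>E\<close> is a functor into \<open>C\<close> with a natural structure that satisfies the equations.\<close>

lemma lift_functor:
  assumes L: "is_functor B C L" and \<psi>: "nat_trans B D (F \<circ>\<^sub>F L) (G \<circ>\<^sub>F L) \<psi>"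
    and eq: "\<And>b i. b \<in> Obj B \<Longrightarrow> l i (fobj L b) (\<psi> b) = r i (fobj L b) (\<psi> b)"
  obtains K where "is_functor B E K"
    "\<And>b. b \<in> Obj B \<Longrightarrow> fobj U (fobj K b) = fobj L b" "\<And>b. b \<in> Obj B \<Longrightarrow> \<phi> (fobj K b) = \<psi> b"
    "\<And>f b c. f \<in> hom B b c \<Longrightarrow> farr U (farr K f) = farr L f"
proof -
  interpret L: is_functor B C L by fact
  have "\<forall>b\<in>Obj B. \<exists>x. x \<in> Obj E \<and> fobj U x = fobj L b \<and> \<phi> x = \<psi> b"
    using lift_object[OF L.F_Obj nat_trans_hom[OF \<psi>, simplified] eq] by blast
  then obtain k where k: "\<And>b. b \<in> Obj B \<Longrightarrow> k b \<in> Obj E" "\<And>b. b \<in> Obj B \<Longrightarrow> fobj U (k b) = fobj L b"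
    "\<And>b. b \<in> Obj B \<Longrightarrow> \<phi> (k b) = \<psi> b"
    by (metis bchoice)
  have "\<exists>e. e \<in> hom E (k (Dom B f)) (k (Cod B f)) \<and> farr U e = farr L f" if "f \<in> Arr B" for f
  proof -
    from that have f: "f \<in> hom B (Dom B f) (Cod B f)" by (simp add: hom_def)
    note x = L.B.hom_Obj(1)[OF f] and y = L.B.hom_Obj(2)[OF f]
    show ?thesis
      using lift_arrow[OF k(1)[OF x] k(1)[OF y], of "farr L f"] L.F_hom[OF f] nat_trans_square[OF \<psi> f]
      by (auto simp: k x y)
  qed
  then obtain e where e: "\<And>f. f \<in> Arr B \<Longrightarrow> e f \<in> hom E (k (Dom B f)) (k (Cod B f))"
    "\<And>f. f \<in> Arr B \<Longrightarrow> farr U (e f) = farr L f"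
    by (metis bchoice)
  have e_hom: "e f \<in> hom E (k b) (k c)" "farr U (e f) = farr L f" if "f \<in> hom B b c" for f b c
    using that e by (auto simp: hom_def)
  let ?K = "\<lparr>fobj = k, farr = e\<rparr>"
  have "is_functor B E ?K"
  proof (unfold_locales; simp)
    fix b assume b: "b \<in> Obj B"
    then show "k b \<in> Obj E" by (rule k)
    show "e (Id B b) = Id E (k b)"
      using e_hom[OF L.B.Id_hom[OF b]] U.B.Id_hom[OF k(1)[OF b]]
      by (intro faithful[of _ "k b" "k b"]) (simp_all add: U.F_Id L.F_Id k b)
  next
    fix f b c assume f: "f \<in> hom B b c"
    then show "e f \<in> hom E (k b) (k c)" by (rule e_hom)
    fix g d assume g: "g \<in> hom B c d"
    note fg = L.B.Comp_hom[OF f g]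
    show "e (Comp B g f) = Comp E (e g) (e f)"
      using e_hom(1)[OF fg] U.B.Comp_hom[OF e_hom(1)[OF f] e_hom(1)[OF g]]
      by (intro faithful[of _ "k b" "k d"])
        (simp_all add: U.F_Comp[OF e_hom(1)[OF f] e_hom(1)[OF g]] L.F_Comp[OF f g] e_hom(2)[OF f] e_hom(2)[OF g] e_hom(2)[OF fg])
  qed
  then show thesis by (rule that) (simp_all add: k e_hom)
qed

text \<open>A factorisation \<open>\<beta> : U R \<Rightarrow> U K\<close> found in \<open>C\<close> lifts to
  \<open>E\<close> as soon as \<open>G \<beta> \<cdot> \<phi>\<^sub>R\<close> and \<open>\<phi>\<^sub>K \<cdot> F \<beta>\<close>, which are transformations into \<open>G U K\<close>, agree, and they do
  so after composition with \<open>G U \<gamma>\<close>.\<close>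

lemma is_ran_reflect:
  assumes H: "is_functor S B H" and J: "is_functor S E J" and K: "is_functor B E K"
    and \<gamma>: "nat_trans S E (K \<circ>\<^sub>F H) J \<gamma>"
    and ran: "is_ran S B C H (U \<circ>\<^sub>F J) (U \<circ>\<^sub>F K) (whisker_l S U \<gamma>)"
    and ranG: "preserves_ran S B D H (U \<circ>\<^sub>F J) (U \<circ>\<^sub>F K) (whisker_l S U \<gamma>) G"
  shows "is_ran S B E H J K \<gamma>"
  unfolding is_ran_iff[OF H J]
proof (intro conjI allI impI K \<gamma>)
  interpret H: is_functor S B H by fact
  interpret J: is_functor S E J by fact
  interpret K: is_functor B E K by fact
  note UJ = is_functor_comp_fun[OF J U.is_functor_axioms]
  note UK = is_functor_comp_fun[OF K U.is_functor_axioms]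
  note GUK = is_functor_comp_fun[OF UK G.is_functor_axioms]
  fix R \<tau> assume R: "is_functor B E R" and \<tau>: "nat_trans S E (R \<circ>\<^sub>F H) J \<tau>"
  interpret R: is_functor B E R by fact
  note UR = is_functor_comp_fun[OF R U.is_functor_axioms]
  note FUR = is_functor_comp_fun[OF UR F.is_functor_axioms]
  note U\<tau> = nat_trans_whisker_l[OF is_functor_comp_fun[OF H R] J U.is_functor_axioms \<tau>, folded comp_fun_assoc]
  obtain \<beta> where \<beta>: "nat_trans B C (U \<circ>\<^sub>F R) (U \<circ>\<^sub>F K) \<beta>"
    and \<beta>\<tau>': "\<And>s. s \<in> Obj S \<Longrightarrow> Comp C (whisker_l S U \<gamma> s) (\<beta> (fobj H s)) = whisker_l S U \<tau> s"
    using ran_factor[OF H UJ ran UR U\<tau>] by blast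
  have \<beta>\<tau>: "Comp C (farr U (\<gamma> s)) (\<beta> (fobj H s)) = farr U (\<tau> s)" if "s \<in> Obj S" for s
    using \<beta>\<tau>'[OF that] that by (simp add: whisker_l_apply)
  note \<beta>_hom = nat_trans_hom[OF \<beta>, simplified]
  note \<gamma>_hom = nat_trans_hom[OF \<gamma>, simplified] and \<tau>_hom = nat_trans_hom[OF \<tau>, simplified]
  have \<phi>_nat: "nat_trans B D (F \<circ>\<^sub>F U \<circ>\<^sub>F X) (G \<circ>\<^sub>F U \<circ>\<^sub>F X) (\<lambda>b\<in>Obj B. \<phi> (fobj X b))"
    if X: "is_functor B E X" for X
  proof -
    interpret X: is_functor B E X by fact
    show ?thesis
      by (rule nat_transI)
        (simp_all add: structure_hom[OF X.F_Obj] structure_square[OF X.F_hom] H.C.category_axioms)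
  qed
  let ?\<phi>R = "\<lambda>b\<in>Obj B. \<phi> (fobj R b)" and ?\<phi>K = "\<lambda>b\<in>Obj B. \<phi> (fobj K b)"
  have "vcomp B D (whisker_l B G \<beta>) ?\<phi>R = vcomp B D ?\<phi>K (whisker_l B F \<beta>)"
  proof (rule ran_eqI[OF H is_functor_comp_fun[OF UJ G.is_functor_axioms] ranG[unfolded preserves_ran_def] FUR])
    show "nat_trans B D (F \<circ>\<^sub>F U \<circ>\<^sub>F R) (G \<circ>\<^sub>F U \<circ>\<^sub>F K) (vcomp B D (whisker_l B G \<beta>) ?\<phi>R)"
      by (rule nat_trans_vcomp[OF FUR is_functor_comp_fun[OF UR G.is_functor_axioms] GUK \<phi>_nat[OF R]
            nat_trans_whisker_l[OF UR UK G.is_functor_axioms \<beta>]])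
    show "nat_trans B D (F \<circ>\<^sub>F U \<circ>\<^sub>F R) (G \<circ>\<^sub>F U \<circ>\<^sub>F K) (vcomp B D ?\<phi>K (whisker_l B F \<beta>))"
      by (rule nat_trans_vcomp[OF FUR is_functor_comp_fun[OF UK F.is_functor_axioms] GUK
            nat_trans_whisker_l[OF UR UK F.is_functor_axioms \<beta>] \<phi>_nat[OF K]])
    fix s assume s: "s \<in> Obj S"
    note b = H.F_Obj[OF s]
    let ?R = "fobj R (fobj H s)" and ?K = "fobj K (fobj H s)"
    note Rs = structure_hom[OF R.F_Obj[OF b]] and Ks = structure_hom[OF K.F_Obj[OF b]]
      and Js = structure_hom[OF J.F_Obj[OF s]]
    note \<beta>s = \<beta>_hom[OF b] and \<gamma>s = U.F_hom[OF \<gamma>_hom[OF s]]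
    have "Comp D (farr G (farr U (\<gamma> s))) (Comp D (farr G (\<beta> (fobj H s))) (\<phi> ?R))
        = Comp D (farr G (farr U (\<tau> s))) (\<phi> ?R)"
      by (simp add: F.C.Comp_assoc[OF Rs G.F_hom[OF \<beta>s] G.F_hom[OF \<gamma>s]] G.F_Comp[OF \<beta>s \<gamma>s, symmetric] \<beta>\<tau>[OF s])
    also have "\<dots> = Comp D (\<phi> (fobj J s)) (farr F (farr U (\<tau> s)))"
      by (rule structure_square[OF \<tau>_hom[OF s]])
    also have "\<dots> = Comp D (Comp D (\<phi> (fobj J s)) (farr F (farr U (\<gamma> s)))) (farr F (\<beta> (fobj H s)))"
      by (simp add: F.C.Comp_assoc[OF F.F_hom[OF \<beta>s] F.F_hom[OF \<gamma>s] Js, symmetric]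
          F.F_Comp[OF \<beta>s \<gamma>s, symmetric] \<beta>\<tau>[OF s])
    also have "\<dots> = Comp D (farr G (farr U (\<gamma> s))) (Comp D (\<phi> ?K) (farr F (\<beta> (fobj H s))))"
      by (simp add: F.C.Comp_assoc[OF F.F_hom[OF \<beta>s] Ks G.F_hom[OF \<gamma>s]] structure_square[OF \<gamma>_hom[OF s]])
    finally show "Comp D (whisker_l S G (whisker_l S U \<gamma>) s) (vcomp B D (whisker_l B G \<beta>) ?\<phi>R (fobj H s))
        = Comp D (whisker_l S G (whisker_l S U \<gamma>) s) (vcomp B D ?\<phi>K (whisker_l B F \<beta>) (fobj H s))"
      by (simp add: whisker_l_apply vcomp_apply s b)
  qed
  then have \<beta>_square: "Comp D (farr G (\<beta> b)) (\<phi> (fobj R b)) = Comp D (\<phi> (fobj K b)) (farr F (\<beta> b))"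
    if "b \<in> Obj B" for b
    by (drule_tac fun_cong[of _ _ b]) (simp add: vcomp_apply whisker_l_apply that)
  have "\<forall>b\<in>Obj B. \<exists>e. e \<in> hom E (fobj R b) (fobj K b) \<and> farr U e = \<beta> b"
    using lift_arrow[OF R.F_Obj K.F_Obj \<beta>_hom \<beta>_square] by blast
  then obtain e where e: "\<And>b. b \<in> Obj B \<Longrightarrow> e b \<in> hom E (fobj R b) (fobj K b)"
    "\<And>b. b \<in> Obj B \<Longrightarrow> farr U (e b) = \<beta> b"
    by (metis bchoice)
  have e_nat: "nat_trans B E R K (restrict e (Obj B))"
  proof (rule nat_transI)
    fix b c f assume f: "f \<in> hom B b c"
    note b = H.C.hom_Obj(1)[OF f] and c = H.C.hom_Obj(2)[OF f]
    show "Comp E (e c) (farr R f) = Comp E (farr K f) (e b)"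
    proof (rule faithful[OF U.B.Comp_hom[OF R.F_hom[OF f] e(1)[OF c]] U.B.Comp_hom[OF e(1)[OF b] K.F_hom[OF f]]])
      show "farr U (Comp E (e c) (farr R f)) = farr U (Comp E (farr K f) (e b))"
        using nat_trans_square[OF \<beta> f]
        by (simp add: U.F_Comp[OF R.F_hom[OF f] e(1)[OF c]] U.F_Comp[OF e(1)[OF b] K.F_hom[OF f]] e b c)
    qed
  qed (simp_all add: e H.C.category_axioms)
  show "\<exists>!\<beta>. nat_trans B E R K \<beta> \<and> (\<forall>s\<in>Obj S. Comp E (\<gamma> s) (\<beta> (fobj H s)) = \<tau> s)"
  proof (rule ex1I[of _ "restrict e (Obj B)"], intro conjI ballI e_nat)
    fix s assume s: "s \<in> Obj S"
    note b = H.F_Obj[OF s]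
    have "Comp E (\<gamma> s) (e (fobj H s)) = \<tau> s"
      by (rule faithful[OF U.B.Comp_hom[OF e(1)[OF b] \<gamma>_hom[OF s]] \<tau>_hom[OF s]])
        (simp add: U.F_Comp[OF e(1)[OF b] \<gamma>_hom[OF s]] e b \<beta>\<tau> s)
    then show "Comp E (\<gamma> s) (restrict e (Obj B) (fobj H s)) = \<tau> s" by (simp add: b)
  next
    fix \<delta> assume "nat_trans B E R K \<delta> \<and> (\<forall>s\<in>Obj S. Comp E (\<gamma> s) (\<delta> (fobj H s)) = \<tau> s)"
    then have \<delta>: "nat_trans B E R K \<delta>" and \<delta>\<tau>: "\<And>s. s \<in> Obj S \<Longrightarrow> Comp E (\<gamma> s) (\<delta> (fobj H s)) = \<tau> s"
      by auto
    have "whisker_l B U \<delta> = \<beta>"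
    proof (rule ran_eqI[OF H UJ ran UR nat_trans_whisker_l[OF R K U.is_functor_axioms \<delta>] \<beta>])
      fix s assume s: "s \<in> Obj S"
      note b = H.F_Obj[OF s]
      show "Comp C (whisker_l S U \<gamma> s) (whisker_l B U \<delta> (fobj H s)) = Comp C (whisker_l S U \<gamma> s) (\<beta> (fobj H s))"
        by (simp add: whisker_l_apply s b \<beta>\<tau> U.F_Comp[OF nat_trans_hom[OF \<delta> b] \<gamma>_hom[OF s], symmetric] \<delta>\<tau>)
    qed
    then have "farr U (\<delta> b) = \<beta> b" if "b \<in> Obj B" for b
      by (drule_tac fun_cong[of _ _ b]) (simp add: whisker_l_apply that)
    then show "\<delta> = restrict e (Obj B)"
      by (intro nat_trans_eqI[OF \<delta> e_nat])
        (simp add: e faithful[OF nat_trans_hom[OF \<delta>] e(1)])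
  qed
qed

text \<open>The pair to be reflected is isomorphic to the absolute Kan extension \<open>L\<close>, and is therefore
  preserved by \<open>G\<close>.\<close>

lemma reflects_absolute_ran:
  assumes H: "is_functor S B H" and J: "is_functor S E J"
    and abs: "absolute_ran S B C H (U \<circ>\<^sub>F J) L \<delta>"
  shows "reflects_ran S B E C H J U"
  unfolding reflects_ran_def
  using is_ran_reflect[OF H J]
    absolute_ran_preserves_ran[OF H is_functor_comp_fun[OF J U.is_functor_axioms] abs _ G.is_functor_axioms]
  by blast

text \<open>The structure \<open>\<psi>\<close> on \<open>L\<close> comes from preservation by \<open>G\<close>, its equations from preservation by the
  \<open>Q i\<close>, and the universal property of the resulting lift from reflection.\<close>

lemma creates_absolute_ran:
  assumes H: "is_functor S B H" and J: "is_functor S E J"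
    and abs: "absolute_ran S B C H (U \<circ>\<^sub>F J) L \<delta>"
  shows "creates_ran S B E C H J U"
proof -
  interpret H: is_functor S B H by fact
  interpret J: is_functor S E J by fact
  note UJ = is_functor_comp_fun[OF J U.is_functor_axioms]
  have ran: "is_ran S B C H (U \<circ>\<^sub>F J) L \<delta>"
    and pres: "is_ran S B X H (M \<circ>\<^sub>F U \<circ>\<^sub>F J) (M \<circ>\<^sub>F L) (whisker_l S M \<delta>)"
    if "is_functor C X M" for X :: "('o, 'm) cat" and M
    using abs that by (simp_all add: absolute_ran_def preserves_ran_def)
  note ran = ran[OF is_functor_id_fun[OF U.C.category_axioms]]
  note L = ran_functor[OF H UJ ran] and \<delta> = ran_counit[OF H UJ ran]
  note \<delta>_hom = nat_trans_hom[OF \<delta>, simplified]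
  interpret L: is_functor B C L by fact
  have LH: "is_functor S C (L \<circ>\<^sub>F H)" by (rule is_functor_comp_fun[OF H L])
  note FLH = is_functor_comp_fun[OF LH F.is_functor_axioms]
  note FUJ = is_functor_comp_fun[OF UJ F.is_functor_axioms]
  note GUJ = is_functor_comp_fun[OF UJ G.is_functor_axioms]
  have \<phi>J: "nat_trans S D (F \<circ>\<^sub>F U \<circ>\<^sub>F J) (G \<circ>\<^sub>F U \<circ>\<^sub>F J) (\<lambda>s\<in>Obj S. \<phi> (fobj J s))"
    by (rule nat_transI)
      (simp_all add: structure_hom[OF J.F_Obj] structure_square[OF J.F_hom] H.B.category_axioms)
  have F\<delta>: "nat_trans S D (F \<circ>\<^sub>F L \<circ>\<^sub>F H) (F \<circ>\<^sub>F U \<circ>\<^sub>F J) (whisker_l S F \<delta>)"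
    by (rule nat_trans_whisker_l[OF LH UJ F.is_functor_axioms \<delta>])
  obtain \<psi> where \<psi>: "nat_trans B D (F \<circ>\<^sub>F L) (G \<circ>\<^sub>F L) \<psi>"
    and \<psi>_eq': "\<And>s. s \<in> Obj S \<Longrightarrow> Comp D (whisker_l S G \<delta> s) (\<psi> (fobj H s)) =
      vcomp S D (\<lambda>s\<in>Obj S. \<phi> (fobj J s)) (whisker_l S F \<delta>) s"
    using ran_factor[OF H GUJ pres[OF G.is_functor_axioms] is_functor_comp_fun[OF L F.is_functor_axioms],
        unfolded comp_fun_assoc, OF nat_trans_vcomp[OF FLH FUJ GUJ F\<delta> \<phi>J]]
    by blast
  have \<psi>_square: "Comp D (farr G (\<delta> s)) (\<psi> (fobj H s)) = Comp D (\<phi> (fobj J s)) (farr F (\<delta> s))"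
    if "s \<in> Obj S" for s
    using \<psi>_eq'[OF that] that by (simp add: whisker_l_apply vcomp_apply)
  \<comment> \<open>Both sides are transformations \<open>P L \<Rightarrow> Q L\<close>; by naturality of \<open>l\<close> and \<open>r\<close> with respect to \<open>\<delta>\<close>,
    composing them with \<open>Q \<delta>\<close> yields the two sides of the equation at \<open>J\<close>.\<close>
  have equation: "l i (fobj L b) (\<psi> b) = r i (fobj L b) (\<psi> b)" if b: "b \<in> Obj B" for i b
  proof -
    have "(\<lambda>b\<in>Obj B. l i (fobj L b) (\<psi> b)) = (\<lambda>b\<in>Obj B. r i (fobj L b) (\<psi> b))"
    proof (rule ran_eqI[OF H is_functor_comp_fun[OF UJ functor_Q[of i]] pres[OF functor_Q[of i]]
          is_functor_comp_fun[OF L functor_P[of i]] inserter_transformation_along[OF transformation_l L \<psi>]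
          inserter_transformation_along[OF transformation_r L \<psi>]])
      fix s assume s: "s \<in> Obj S"
      note b = H.F_Obj[OF s]
      note Ls = nat_trans_hom[OF \<psi> b, simplified] and Js = structure_hom[OF J.F_Obj[OF s]]
      show "Comp (T i) (whisker_l S (Q i) \<delta> s) ((\<lambda>b\<in>Obj B. l i (fobj L b) (\<psi> b)) (fobj H s)) =
          Comp (T i) (whisker_l S (Q i) \<delta> s) ((\<lambda>b\<in>Obj B. r i (fobj L b) (\<psi> b)) (fobj H s))"
        using inserter_transformation_square[OF transformation_l[of i] \<delta>_hom[OF s] Ls Js \<psi>_square[OF s]]
          inserter_transformation_square[OF transformation_r[of i] \<delta>_hom[OF s] Ls Js \<psi>_square[OF s]]
        by (simp add: whisker_l_apply s b structure_equation[OF J.F_Obj[OF s]])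
    qed
    from fun_cong[OF this, of b] b show ?thesis by simp
  qed
  obtain K where K: "is_functor B E K"
    and K_lift: "\<And>b. b \<in> Obj B \<Longrightarrow> fobj U (fobj K b) = fobj L b" "\<And>b. b \<in> Obj B \<Longrightarrow> \<phi> (fobj K b) = \<psi> b"
      "\<And>f b c. f \<in> hom B b c \<Longrightarrow> farr U (farr K f) = farr L f"
    using lift_functor[OF L \<psi> equation] by blast
  interpret K: is_functor B E K by fact
  have "\<forall>s\<in>Obj S. \<exists>e. e \<in> hom E (fobj K (fobj H s)) (fobj J s) \<and> farr U e = \<delta> s"
  proof
    fix s assume s: "s \<in> Obj S"
    note b = H.F_Obj[OF s]
    show "\<exists>e. e \<in> hom E (fobj K (fobj H s)) (fobj J s) \<and> farr U e = \<delta> s"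
      using lift_arrow[OF K.F_Obj[OF b] J.F_Obj[OF s], of "\<delta> s"] \<delta>_hom[OF s] \<psi>_square[OF s]
      by (auto simp: K_lift b)
  qed
  then obtain e where e: "\<And>s. s \<in> Obj S \<Longrightarrow> e s \<in> hom E (fobj K (fobj H s)) (fobj J s)"
    "\<And>s. s \<in> Obj S \<Longrightarrow> farr U (e s) = \<delta> s"
    by (metis bchoice)
  have e_nat: "nat_trans S E (K \<circ>\<^sub>F H) J (restrict e (Obj S))"
  proof (rule nat_transI)
    fix s t f assume f: "f \<in> hom S s t"
    note s = H.B.hom_Obj(1)[OF f] and t = H.B.hom_Obj(2)[OF f]
    note KHf = K.F_hom[OF H.F_hom[OF f]] and Jf = J.F_hom[OF f]
    have "Comp E (e t) (farr K (farr H f)) = Comp E (farr J f) (e s)"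
      by (rule faithful[OF U.B.Comp_hom[OF KHf e(1)[OF t]] U.B.Comp_hom[OF e(1)[OF s] Jf]])
        (use nat_trans_square[OF \<delta> f] in
          \<open>simp add: U.F_Comp[OF KHf e(1)[OF t]] U.F_Comp[OF e(1)[OF s] Jf] e s t K_lift(3)[OF H.F_hom[OF f]]\<close>)
    then show "Comp E (e t) (farr (K \<circ>\<^sub>F H) f) = Comp E (farr J f) (e s)" by simp
  qed (simp_all add: e H.B.category_axioms)
  have Ue: "whisker_l S U (restrict e (Obj S)) = \<delta>"
    by (rule nat_trans_eqI[OF nat_trans_whisker_l[OF is_functor_comp_fun[OF H K] J U.is_functor_axioms e_nat] \<delta>])
      (simp add: whisker_l_apply e)
  have "is_ran S B C H (U \<circ>\<^sub>F J) (U \<circ>\<^sub>F K) \<delta>"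
    by (rule is_ran_cong_functor[OF H UJ ran is_functor_comp_fun[OF K U.is_functor_axioms]])
      (simp_all add: K_lift)
  then have pK: "preserves_ran S B C H J K (restrict e (Obj S)) U"
    by (simp add: preserves_ran_def Ue)
  have refl: "reflects_ran S B E C H J U" by (rule reflects_absolute_ran[OF H J abs])
  then have "is_ran S B E H J K (restrict e (Obj S))"
    using pK K e_nat unfolding reflects_ran_def preserves_ran_def by blast
  with refl pK show ?thesis unfolding creates_ran_def by blast
qed

end

section \<open>Duality\<close>

lemma vcomp_op: "vcomp (op_cat B) (op_cat C) \<beta> \<alpha> = vcomp B C \<alpha> \<beta>"
  by (simp add: vcomp_def)

lemma whisker_op: "whisker_r (op_cat S) = whisker_r S" "whisker_l (op_cat S) = whisker_l S"
  by (simp_all add: whisker_r_def whisker_l_def fun_eq_iff)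

lemma is_ran_op_iff: "is_ran (op_cat S) (op_cat B) (op_cat C) H J K \<eta> \<longleftrightarrow> is_lan S B C H J K \<eta>"
proof -
  have "(\<forall>R. is_functor (op_cat B) (op_cat C) R \<longrightarrow> X R) \<longleftrightarrow> (\<forall>R. is_functor B C R \<longrightarrow> X R)" for X
    by (simp add: is_functor_op_iff)
  then show ?thesis
    by (simp add: is_ran_def is_lan_def is_functor_op_iff nat_trans_op_iff vcomp_op whisker_op)
qed

lemma reflects_ran_op_iff:
  "reflects_ran (op_cat S) (op_cat B) (op_cat C) (op_cat D) H J G \<longleftrightarrow> reflects_lan S B C D H J G"
  by (simp add: reflects_ran_def reflects_lan_def is_ran_op_iff is_functor_op_iff nat_trans_op_iff whisker_op)

lemma creates_ran_op_iff:
  "creates_ran (op_cat S) (op_cat B) (op_cat C) (op_cat D) H J G \<longleftrightarrow> creates_lan S B C D H J G"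
  by (simp add: creates_ran_def creates_lan_def reflects_ran_op_iff is_ran_op_iff whisker_op
      preserves_ran_def preserves_lan_def)

text \<open>Absoluteness is tested against all targets \<open>D\<close>, and \<^const>\<open>op_cat\<close> is a bijection on these.\<close>

lemma absolute_ran_op_iff:
  fixes C :: "('o, 'm) cat"
  shows "absolute_ran (op_cat S) (op_cat B) (op_cat C) H J K \<eta> \<longleftrightarrow> absolute_lan S B C H J K \<eta>"
proof -
  have all_op: "(\<forall>(D :: ('o, 'm) cat) G. X D G) \<longleftrightarrow> (\<forall>(D :: ('o, 'm) cat) G. X (op_cat D) G)"
    for X :: "('o, 'm) cat \<Rightarrow> ('o, 'm, 'o, 'm) fun_data \<Rightarrow> bool"
    by (metis op_cat_op_cat)
  have "(\<forall>(D :: ('o, 'm) cat) G. is_functor (op_cat C) D G \<longrightarrow>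
        is_ran (op_cat S) (op_cat B) D H (G \<circ>\<^sub>F J) (G \<circ>\<^sub>F K) (whisker_l S G \<eta>)) \<longleftrightarrow>
      (\<forall>(D :: ('o, 'm) cat) G. is_functor C D G \<longrightarrow>
        is_lan S B D H (G \<circ>\<^sub>F J) (G \<circ>\<^sub>F K) (whisker_l S G \<eta>))"
    by (subst all_op) (simp add: is_functor_op_iff is_ran_op_iff)
  then show ?thesis
    by (simp add: absolute_ran_def absolute_lan_def preserves_ran_def preserves_lan_def is_ran_op_iff whisker_op)
qed

context equifier_of_inserter
begin

lemma creates_absolute_lan:
  assumes H: "is_functor S B H" and J: "is_functor S E J"
    and abs: "absolute_lan S B C H (U \<circ>\<^sub>F J) L \<delta>"
  shows "creates_lan S B E C H J U"
  using equifier_of_inserter.creates_absolute_ran[OF opposite, of "op_cat S" "op_cat B" H J L \<delta>] assms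
  by (simp add: is_functor_op_iff absolute_ran_op_iff creates_ran_op_iff)

lemma creates_absolute_kan: "creates_absolute_kan_extensions TYPE('so \<times> 'sm \<times> 'bo \<times> 'bm) E C U"
  unfolding creates_absolute_kan_extensions_def
  using creates_absolute_ran creates_absolute_lan by blast

end

text \<open>Limits and colimits are Kan extensions along the functor to the terminal category.\<close>

lemma is_functor_to_terminal: "category S \<Longrightarrow> is_functor S terminal_cat to_terminal"
  by (simp add: is_functor_def is_functor_axioms_def category_def terminal_cat_def to_terminal_def hom_def)

lemma creates_absolute_limits_colimits:
  assumes "creates_absolute_kan_extensions TYPE('so \<times> 'sm \<times> unit \<times> unit) C D G"
  shows "creates_absolute_limits TYPE('so \<times> 'sm) C D G" "creates_absolute_colimits TYPE('so \<times> 'sm) C D G"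
  using assms is_functor_to_terminal is_functor.axioms(1)
  unfolding creates_absolute_kan_extensions_def creates_absolute_limits_def creates_absolute_colimits_def
  by blast+

section \<open>Lax descent\<close>

text \<open>The two sides of each descent axiom are composites of three kinds of transformations: those that do not
  depend on \<open>\<psi>\<close>, inverses of such, and the images of \<open>\<psi>\<close> under a functor out of \<open>D\<close>.\<close>

context
  fixes C :: "('co, 'cm) cat" and D :: "('do, 'dm) cat" and T :: "('to, 'tm) cat"
    and F G :: "('co, 'cm, 'do, 'dm) fun_data"
  assumes T: "category T"
begin

lemma inserter_transformation_nat:
  assumes "nat_trans C T P Q \<alpha>"
  shows "inserter_transformation C D F G T P Q (\<lambda>w \<psi>. \<alpha> w)"
  using assms by (simp add: inserter_transformation_def nat_trans_def)

lemma inserter_transformation_inv: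
  assumes P: "is_functor C T P" and Q: "is_functor C T Q" and iso: "nat_iso C T P Q \<alpha>"
  shows "inserter_transformation C D F G T Q P (\<lambda>w \<psi>. inv_arr T (\<alpha> w))"
proof -
  interpret T: category T by (rule T)
  interpret P: is_functor C T P by fact
  interpret Q: is_functor C T Q by fact
  have \<alpha>: "nat_trans C T P Q \<alpha>" and i: "\<And>w. w \<in> Obj C \<Longrightarrow> is_iso T (\<alpha> w)"
    using iso by (auto simp: nat_iso_def)
  have "Comp T (farr P m) (inv_arr T (\<alpha> w)) = Comp T (inv_arr T (\<alpha> w')) (farr Q m)"
    if m: "m \<in> hom C w w'" for m w w'
  proof -
    note w = P.B.hom_Obj(1)[OF m] and w' = P.B.hom_Obj(2)[OF m]
    show ?thesis
      by (rule T.inv_square[OF i[OF w] nat_trans_hom[OF \<alpha> w] i[OF w'] nat_trans_hom[OF \<alpha> w'] P.F_hom[OF m]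
            Q.F_hom[OF m] nat_trans_square[OF \<alpha> m], symmetric])
  qed
  then show ?thesis
    using T.inv_arr(1)[OF i nat_trans_hom[OF \<alpha>]] by (simp add: inserter_transformation_def)
qed

lemma inserter_transformation_arr:
  assumes F: "is_functor C D F" and G: "is_functor C D G" and M: "is_functor D T M"
  shows "inserter_transformation C D F G T (M \<circ>\<^sub>F F) (M \<circ>\<^sub>F G) (\<lambda>w \<psi>. farr M \<psi>)"
proof -
  interpret F: is_functor C D F by fact
  interpret G: is_functor C D G by fact
  interpret M: is_functor D T M by fact
  show ?thesis unfolding inserter_transformation_def
  proof (intro conjI ballI allI impI)
    fix w w' m \<psi> \<psi>'
    assume *: "m \<in> hom C w w'" "\<psi> \<in> hom D (fobj F w) (fobj G w)" "\<psi>' \<in> hom D (fobj F w') (fobj G w')"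
      "Comp D (farr G m) \<psi> = Comp D \<psi>' (farr F m)"
    show "Comp T (farr (M \<circ>\<^sub>F G) m) (farr M \<psi>) = Comp T (farr M \<psi>') (farr (M \<circ>\<^sub>F F) m)"
      using *(4) by (simp add: M.F_Comp[OF *(2) G.F_hom[OF *(1)], symmetric] M.F_Comp[OF F.F_hom[OF *(1)] *(3), symmetric])
  qed (simp add: M.F_hom)
qed

lemma inserter_transformation_comp:
  assumes P: "is_functor C T P" and Q: "is_functor C T Q" and R: "is_functor C T R"
    and l: "inserter_transformation C D F G T P Q l" and k: "inserter_transformation C D F G T Q R k"
  shows "inserter_transformation C D F G T P R (\<lambda>w \<psi>. Comp T (k w \<psi>) (l w \<psi>))"
proof -
  interpret T: category T by (rule T)
  interpret P: is_functor C T P by fact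
  interpret Q: is_functor C T Q by fact
  interpret R: is_functor C T R by fact
  show ?thesis unfolding inserter_transformation_def
  proof (intro conjI ballI allI impI)
    fix w \<psi> assume *: "w \<in> Obj C" "\<psi> \<in> hom D (fobj F w) (fobj G w)"
    show "Comp T (k w \<psi>) (l w \<psi>) \<in> hom T (fobj P w) (fobj R w)"
      by (rule T.Comp_hom[OF inserter_transformation_hom[OF l *] inserter_transformation_hom[OF k *]])
  next
    fix w w' m \<psi> \<psi>'
    assume *: "m \<in> hom C w w'" "\<psi> \<in> hom D (fobj F w) (fobj G w)" "\<psi>' \<in> hom D (fobj F w') (fobj G w')"
      "Comp D (farr G m) \<psi> = Comp D \<psi>' (farr F m)"
    note w = P.B.hom_Obj(1)[OF *(1)] and w' = P.B.hom_Obj(2)[OF *(1)]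
    show "Comp T (farr R m) (Comp T (k w \<psi>) (l w \<psi>)) = Comp T (Comp T (k w' \<psi>') (l w' \<psi>')) (farr P m)"
      by (rule T.paste_squares[OF inserter_transformation_hom[OF l w *(2)] inserter_transformation_hom[OF k w *(2)]
            inserter_transformation_hom[OF l w' *(3)] inserter_transformation_hom[OF k w' *(3)]
            P.F_hom[OF *(1)] Q.F_hom[OF *(1)] R.F_hom[OF *(1)]
            inserter_transformation_square[OF l *] inserter_transformation_square[OF k *]])
  qed
qed

text \<open>The cells \<open>\<sigma>\<^sub>i\<^sub>j\<close> and \<open>\<nn>\<^sub>i\<close> all have this form, with \<open>R\<close> the value of the pseudofunctor at the
  arrow that two composites of generators have in common.\<close>

lemma inserter_transformation_mate:
  assumes "is_functor C T P" "is_functor C T Q" "is_functor C T R"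
    and "nat_iso C T P R \<alpha>" "nat_iso C T Q R \<beta>"
  shows "inserter_transformation C D F G T P Q (\<lambda>w \<psi>. Comp T (inv_arr T (\<beta> w)) (\<alpha> w))"
  using assms
  by (intro inserter_transformation_comp[where Q = R] inserter_transformation_nat inserter_transformation_inv)
    (simp_all add: nat_iso_def)

end

context
  fixes A :: "('o, 'm) desc_data"
  assumes A: "pseudofunctor Delta3 A"
  notes One_nat_def [simp del]
begin

interpretation A: pseudofunctor Delta3 A by (rule A)

text \<open>The index \<open>cocycle\<close> selects between the associativity axiom, an equation in \<open>\<A>(3)\<close>, and the
  unit axiom, an equation in \<open>\<A>(1)\<close>.\<close>

lemma lax_desc_equifier:
  "equifier_of_inserter (lax_desc A) (PObj A 1) (PObj A 2) (forget_desc A) (PArr A (dd 1)) (PArr A (dd 0)) snd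
    (\<lambda>cocycle. PObj A (if cocycle then 3 else 1))
    (\<lambda>cocycle. if cocycle then PArr A (DD 2) \<circ>\<^sub>F PArr A (dd 1) else PArr A s0 \<circ>\<^sub>F PArr A (dd 1))
    (\<lambda>cocycle. if cocycle then PArr A (DD 0) \<circ>\<^sub>F PArr A (dd 0) else id_fun)
    (\<lambda>cocycle w \<psi>. if cocycle
       then Comp (PObj A 3) (farr (PArr A (DD 0)) \<psi>) (Comp (PObj A 3) (\<sigma>02 A w) (farr (PArr A (DD 2)) \<psi>))
       else Comp (PObj A 1) (\<nn>0 A w) (farr (PArr A s0) \<psi>))
    (\<lambda>cocycle w \<psi>. if cocycle
       then Comp (PObj A 3) (\<sigma>01 A w) (Comp (PObj A 3) (farr (PArr A (DD 1)) \<psi>) (\<sigma>12 A w))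
       else \<nn>1 A w)"
proof -
  let ?F = "PArr A (dd 1)" and ?G = "PArr A (dd 0)"
  have cat: "category (PObj A 1)" "category (PObj A 3)"
    using A.P_Obj by (simp_all add: Delta3_def)
  have U: "is_functor (lax_desc A) (PObj A 1) (forget_desc A)" by (rule is_functor_forget_desc[OF A])
  have d: "is_functor (PObj A 1) (PObj A 2) (PArr A (dd i))" if "i \<in> {0, 1}" for i
    using A.P_Arr Delta3_hom(1)[OF that] by simp
  have s: "is_functor (PObj A 2) (PObj A 1) (PArr A s0)"
    using A.P_Arr Delta3_hom(2) by simp
  have D: "is_functor (PObj A 2) (PObj A 3) (PArr A (DD i))" if "i \<in> {0, 1, 2}" for i
    using A.P_Arr Delta3_hom(3)[OF that] by simp
  have Dd: "is_functor (PObj A 1) (PObj A 3) (PArr A (DD j) \<circ>\<^sub>F PArr A (dd i))"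
    if "i \<in> {0, 1}" "j \<in> {0, 1, 2}" for i j
    by (rule is_functor_comp_fun[OF d[OF that(1)] D[OF that(2)]])
  have sd: "is_functor (PObj A 1) (PObj A 1) (PArr A s0 \<circ>\<^sub>F PArr A (dd i))" if "i \<in> {0, 1}" for i
    by (rule is_functor_comp_fun[OF d[OF that] s])
  have comp: "is_functor (PObj A 1) (PObj A 3) (PArr A (Comp Delta3 (DD j) (dd i)))"
    "nat_iso (PObj A 1) (PObj A 3) (PArr A (DD j) \<circ>\<^sub>F PArr A (dd i)) (PArr A (Comp Delta3 (DD j) (dd i)))
       (PComp A (DD j) (dd i))"
    if "i \<in> {0, 1}" "j \<in> {0, 1, 2}" for i j
    using A.P_Arr[OF A.Comp_hom[OF Delta3_hom(1)[OF that(1)] Delta3_hom(3)[OF that(2)]]]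
      A.P_Comp[OF Delta3_hom(1)[OF that(1)] Delta3_hom(3)[OF that(2)]] by simp_all
  have one: "1 \<in> Obj Delta3" by (simp add: Delta3_def)
  have unit: "is_functor (PObj A 1) (PObj A 1) (PArr A (Id Delta3 1))"
    "nat_iso (PObj A 1) (PObj A 1) id_fun (PArr A (Id Delta3 1)) (PUnit A 1)"
    using A.P_Arr[OF A.Id_hom[OF one]] A.P_Unit[OF one] by simp_all
  have comp_s: "nat_iso (PObj A 1) (PObj A 1) (PArr A s0 \<circ>\<^sub>F PArr A (dd i)) (PArr A (Id Delta3 1)) (PComp A s0 (dd i))"
    if "i \<in> {0, 1}" for i
    using A.P_Comp[OF Delta3_hom(1)[OF that] Delta3_hom(2)] Delta3_relations(1,2) that by auto
  let ?trans = "inserter_transformation (PObj A 1) (PObj A 2) ?F ?G"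
  note mate = inserter_transformation_mate[of _ "PObj A 1" _ _ _ _ _ "PObj A 2" ?F ?G]
  have id: "is_functor (PObj A 1) (PObj A 1) id_fun" by (rule is_functor_id_fun[OF cat(1)])
  have \<sigma>: "?trans (PObj A 3) (PArr A (DD 1) \<circ>\<^sub>F ?G) (PArr A (DD 0) \<circ>\<^sub>F ?G) (\<lambda>w \<psi>. \<sigma>01 A w)"
    "?trans (PObj A 3) (PArr A (DD 2) \<circ>\<^sub>F ?G) (PArr A (DD 0) \<circ>\<^sub>F ?F) (\<lambda>w \<psi>. \<sigma>02 A w)"
    "?trans (PObj A 3) (PArr A (DD 2) \<circ>\<^sub>F ?F) (PArr A (DD 1) \<circ>\<^sub>F ?F) (\<lambda>w \<psi>. \<sigma>12 A w)"
    unfolding \<sigma>01_def \<sigma>02_def \<sigma>12_def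
    using mate[OF cat(2) Dd[of 0 1] Dd[of 0 0] comp(1)[of 0 0] _ comp(2)[of 0 0], of "PComp A (DD 1) (dd 0)"]
      mate[OF cat(2) Dd[of 0 2] Dd[of 1 0] comp(1)[of 1 0] _ comp(2)[of 1 0], of "PComp A (DD 2) (dd 0)"]
      mate[OF cat(2) Dd[of 1 2] Dd[of 1 1] comp(1)[of 1 1] _ comp(2)[of 1 1], of "PComp A (DD 2) (dd 1)"]
      comp(2)[of 0 1] comp(2)[of 0 2] comp(2)[of 1 2] Delta3_relations
    by simp_all
  have \<nn>: "?trans (PObj A 1) (PArr A s0 \<circ>\<^sub>F ?G) id_fun (\<lambda>w \<psi>. \<nn>0 A w)"
    "?trans (PObj A 1) (PArr A s0 \<circ>\<^sub>F ?F) id_fun (\<lambda>w \<psi>. \<nn>1 A w)"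
    unfolding \<nn>0_def \<nn>1_def
    using mate[OF cat(1) sd[of 0] id unit(1) comp_s[of 0] unit(2)] mate[OF cat(1) sd[of 1] id unit(1) comp_s[of 1] unit(2)]
    by simp_all
  have D_trans: "?trans (PObj A 3) (PArr A (DD i) \<circ>\<^sub>F ?F) (PArr A (DD i) \<circ>\<^sub>F ?G) (\<lambda>w \<psi>. farr (PArr A (DD i)) \<psi>)"
    if "i \<in> {0, 1, 2}" for i
    using inserter_transformation_arr[OF cat(2) d[of 1] d[of 0] D[OF that]] by simp
  have s_trans: "?trans (PObj A 1) (PArr A s0 \<circ>\<^sub>F ?F) (PArr A s0 \<circ>\<^sub>F ?G) (\<lambda>w \<psi>. farr (PArr A s0) \<psi>)"
    using inserter_transformation_arr[OF cat(1) d[of 1] d[of 0] s] by simp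
  have cocycle_l: "?trans (PObj A 3) (PArr A (DD 2) \<circ>\<^sub>F ?F) (PArr A (DD 0) \<circ>\<^sub>F ?G)
      (\<lambda>w \<psi>. Comp (PObj A 3) (farr (PArr A (DD 0)) \<psi>) (Comp (PObj A 3) (\<sigma>02 A w) (farr (PArr A (DD 2)) \<psi>)))"
    by (rule inserter_transformation_comp[OF cat(2) Dd Dd Dd
          inserter_transformation_comp[OF cat(2) Dd Dd Dd D_trans \<sigma>(2)] D_trans]) simp_all
  have cocycle_r: "?trans (PObj A 3) (PArr A (DD 2) \<circ>\<^sub>F ?F) (PArr A (DD 0) \<circ>\<^sub>F ?G)
      (\<lambda>w \<psi>. Comp (PObj A 3) (\<sigma>01 A w) (Comp (PObj A 3) (farr (PArr A (DD 1)) \<psi>) (\<sigma>12 A w)))"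
    by (rule inserter_transformation_comp[OF cat(2) Dd Dd Dd
          inserter_transformation_comp[OF cat(2) Dd Dd Dd \<sigma>(3) D_trans] \<sigma>(1)]) simp_all
  have unit_l: "?trans (PObj A 1) (PArr A s0 \<circ>\<^sub>F ?F) id_fun (\<lambda>w \<psi>. Comp (PObj A 1) (\<nn>0 A w) (farr (PArr A s0) \<psi>))"
    by (rule inserter_transformation_comp[OF cat(1) sd sd id s_trans \<nn>(1)]) simp_all
  show ?thesis
    unfolding equifier_of_inserter_def equifier_of_inserter_axioms_def
  proof (intro conjI allI impI)
    fix w \<psi> assume w\<psi>: "w \<in> Obj (PObj A 1)" "\<psi> \<in> hom (PObj A 2) (fobj ?F w) (fobj ?G w)"
    assume equations: "\<forall>cocycle.
      (if cocycle
       then Comp (PObj A 3) (farr (PArr A (DD 0)) \<psi>) (Comp (PObj A 3) (\<sigma>02 A w) (farr (PArr A (DD 2)) \<psi>))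
       else Comp (PObj A 1) (\<nn>0 A w) (farr (PArr A s0) \<psi>)) =
      (if cocycle
       then Comp (PObj A 3) (\<sigma>01 A w) (Comp (PObj A 3) (farr (PArr A (DD 1)) \<psi>) (\<sigma>12 A w))
       else \<nn>1 A w)"
    have "(w, \<psi>) \<in> Obj (lax_desc A)"
      using w\<psi> spec[OF equations, of True, unfolded if_True] spec[OF equations, of False, unfolded if_False]
      by (simp add: lax_desc_def lax_desc_obj_def)
    then show "\<exists>x\<in>Obj (lax_desc A). fobj (forget_desc A) x = w \<and> snd x = \<psi>"
      by (intro bexI[of _ "(w, \<psi>)"]) (simp_all add: forget_desc_def)
  qed (use U d[of 0] d[of 1] Dd[of 1 2] Dd[of 0 0] sd[of 1] id cocycle_l cocycle_r unit_l \<nn>(2) in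
      \<open>auto simp: lax_desc_def lax_desc_obj_def forget_desc_def hom_def\<close>)
qed

end

theorem corollary3p5:
  fixes \<CC> :: "('c, 'd) cat"
    and \<F> :: "('c, 'd, 'o, 'm) pfun_data"
    and a :: "(nat, nat \<times> (nat \<Rightarrow> nat) \<times> nat, 'c, 'd) fun_data"
  assumes "category \<CC>"
    and "pseudofunctor (op_cat \<CC>) \<F>"
    and "is_functor (op_cat Delta3) \<CC> a"
  shows "creates_absolute_kan_extensions TYPE('so \<times> 'sm \<times> 'bo \<times> 'bm)
           (IntAct \<F> a) (PObj \<F> (fobj a 1)) (forget_desc (\<F> \<circ>\<^sub>P op_fun a))
    \<and> creates_absolute_limits TYPE('lo \<times> 'lm)
           (IntAct \<F> a) (PObj \<F> (fobj a 1)) (forget_desc (\<F> \<circ>\<^sub>P op_fun a))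
    \<and> creates_absolute_colimits TYPE('lo \<times> 'lm)
           (IntAct \<F> a) (PObj \<F> (fobj a 1)) (forget_desc (\<F> \<circ>\<^sub>P op_fun a))"
proof -
  have "pseudofunctor Delta3 (\<F> \<circ>\<^sub>P op_fun a)"
    using pseudofunctor_pfun_comp_fun[OF assms(2)] is_functor_op_fun[OF assms(3)]
    by (simp add: op_cat_op_cat)
  note equifier = lax_desc_equifier[OF this]
  have "PObj (\<F> \<circ>\<^sub>P op_fun a) 1 = PObj \<F> (fobj a 1)"
    by (simp add: pfun_comp_fun_def op_fun_def)
  note kan = equifier_of_inserter.creates_absolute_kan[OF equifier, unfolded this, folded IntAct_def]
  show ?thesis
    by (intro conjI kan creates_absolute_limits_colimits[OF kan])
qed

end
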